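(* Suppose the standing assumption and the sequential constraint qualification in the context hold (with constant $\sigma_{\min}>0$) and the algorithm in the context does not terminate finitely. Let $\chi_k:=\max\{\|g_k+g_{r,k}+J_k^Ty_k+z_k\|_2,\ \|c_k\|_2,\ \|\min\{x_k,-z_k\}\|_2\}$, $\kappa_1:=\gamma\eta_m(1-\eta_m)$, $$\tau_{\min,\mathrm{trial}}:=\frac{(1-\sigma_c)\kappa_1\sigma_{\min}^2\min\left\{\frac{1}{(1+\kappa_J^2)\alpha_0},\kappa_v\right\}}{2(\kappa_{\nabla f}+\kappa_{\partial r})\kappa_v\kappa_J+2\kappa_v^2\kappa_J^2\kappa_c},\quad \tau_{\min}:=\min\{\tau_0,(1-\epsilon_\tau)\tau_{\min,\mathrm{trial}}\},$$ $\alpha_{\min}:=\min\left\{\alpha_0,\frac{\xi\tau_{\min}}{2(\tau_{\min}L_g+L_J)}\right\}$, and $$\kappa_\Phi:=\eta_\Phi\min\left\{\frac{\tau_{\min}\alpha_{\min}}{8},\ \frac{\tau_{\min}}{8\alpha_0},\ \frac{\sigma_c\kappa_1}{\kappa_c}\sigma_{\min}^2\min\left\{\frac1{1+\kappa_J^2},\kappa_v\alpha_{\min}\right\}\right\}.$$ Let $\epsilon>0$ be given. If $\{k_1,k_2\}\subset\mathbb{N}$ are two iterations with $k_1<k_2$ such that $k\in\mathcal{S}$ and $\chi_k>\epsilon$ for all iterations $k_1\le k<k_2$, then $$k_2-k_1\le\left\lfloor\frac{\tau_0(f(x_0)+r(x_0)-f_{\inf})+\|c(x_0)\|_2}{\kappa_\Phi\epsilon^2}\right\rfloor.$$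 Moreover, the maximum number of iterations before $\chi_k\le\epsilon$ for some iteration $k\in\mathbb{N}$ is $$\left(\max\left\{0,\left\lceil\frac{\log\left(\frac{\tau_{\min}}{2\alpha_0(\tau_{\min}L_g+L_J)}\right)}{\log(\xi)}\right\rceil\right\}+1\right)\left\lfloor\frac{\tau_0(f(x_0)-f_{\inf}+r(x_0))+\|c(x_0)\|_2}{\kappa_\Phi\epsilon^2}\right\rfloor.$$
   Context: Problem and notation. Consider $\min_{x\in\mathbb{R}^n} f(x)+r(x)$ subject to $c(x)=0$, $x\in\Omega$, where $f:\mathbb{R}^n\to\mathbb{R}$ and $c:\mathbb{R}^n\to\mathbb{R}^m$ ($m\le n$) are continuously differentiable, $r:\mathbb{R}^n\to[0,\infty)$ is convex (possibly nonsmooth), and $\Omega=\{x\in\mathbb{R}^n: x\ge0\}$. Let $g=\nabla f$ and $J(x)=\nabla c(x)^T\in\mathbb{R}^{m\times n}$ (the Jacobian); $f_k,r_k,g_k,c_k,J_k$ denote values at $x_k$; $\mathbb{N}=\{0,1,2,\dots\}$; minima/maxima of vectors are componentwise; $\mathrm{Proj}_C$ is Euclidean projection onto $C$; $T_\Omega(x)$ is the tangent cone of $\Omega$ at $x$. Algorithm. Inputs: $x_0\in\Omega$, $\alpha_0,\tau_{-1},\kappa_v>0$, and $\xi,\eta_\Phi,\sigma_c,\epsilon_\tau,\gamma,\eta_m\in(0,1)$. For $k=0,1,2,\dots$: (1) Let $\delta_k=\|\mathrm{Proj}_{T_\Omega(x_k)}(-J_k^Tc_k)\|_2$, $m_k(v)=\frac12\|c_k+J_kv\|_2^2$,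 and $v_k(\beta)=\mathrm{Proj}_\Omega(x_k-\beta J_k^Tc_k)-x_k$ for $\beta>0$. The Cauchy point is $v_k^c=v_k(\beta_k)$ with $\beta_k=\gamma^{i_k}$, where $i_k$ is the smallest nonnegative integer such that $\|v_k(\beta_k)\|_2\le\kappa_v\alpha_k\delta_k$ and $m_k(v_k(\beta_k))\le m_k(0)+\eta_m\nabla m_k(0)^Tv_k(\beta_k)$. (2) If $\delta_k=0$, set $v_k=0$ and, if additionally $c_k\ne0$, terminate returning $x_k$. If $\delta_k\neq0$, let $v_k$ be any vector with $\|v_k\|_2\le\kappa_v\alpha_k\delta_k$, $x_k+v_k\in\Omega$, and $m_k(v_k)\le m_k(v_k^c)$. (3) Let $u_k$ be the unique minimizer of $g_k^Tu+\frac{1}{2\alpha_k}\|u\|_2^2+\frac1{\alpha_k}v_k^Tu+r(x_k+v_k+u)$ over $u\in\mathbb{R}^n$ with $J_ku=0$, $x_k+v_k+u\in\Omega$; set $s_k=v_k+u_k$. Let $g_{r,k}\in\partial r(x_k+v_k+u_k)$, $y_k\in\mathbb{R}^m$, $z_k\in\mathbb{R}^n$ satisfy the optimality conditions $g_k+\frac1{\alpha_k}u_k+\frac1{\alpha_k}v_k+g_{r,k}+J_k^Ty_k+z_k=0$, $J_ku_k=0$, $\min\{x_k+v_k+u_k,-z_k\}=0$ (such quantities exist). (4) If $s_k=0$, terminate returning $x_k$. (5) Let $A_k=g_k^Ts_k+\frac1{2\alpha_k}\|s_k\|_2^2+r(x_k+s_k)-r_k$; $\tau_{k,\mathrm{trial}}=\infty$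 if $A_k\le0$ and $\tau_{k,\mathrm{trial}}=(1-\sigma_c)(\|c_k\|_2-\|c_k+J_ks_k\|_2)/A_k$ otherwise; $\tau_k=\tau_{k-1}$ if $\tau_{k-1}\le\tau_{k,\mathrm{trial}}$ and $\tau_k=\min\{(1-\epsilon_\tau)\tau_{k-1},\tau_{k,\mathrm{trial}}\}$ otherwise. (6) With $\Phi_\tau(x)=\tau(f(x)+r(x))+\|c(x)\|_2$: if $\Phi_{\tau_k}(x_k+s_k)-\Phi_{\tau_k}(x_k)\le-\eta_\Phi\left(\frac{\tau_k}{4\alpha_k}\|s_k\|_2^2+\sigma_c(\|c_k\|_2-\|c_k+J_ks_k\|_2)\right)$, set $x_{k+1}=x_k+s_k$, $\alpha_{k+1}=\alpha_k$; otherwise set $x_{k+1}=x_k$, $\alpha_{k+1}=\xi\alpha_k$. $\mathcal{S}=\{k\in\mathbb{N}:x_{k+1}=x_k+s_k\}$ is the set of successful iterations. Standing assumption. There is an open convex set $\mathcal{X}\subseteq\mathbb{R}^n$ containing all $x_k$ and $x_k+v_k$ such that, over $\mathcal{X}$, $f$ and each $c_i$ are bounded, $\nabla f$ and each $\nabla c_i$ are Lipschitz continuous and bounded in norm, and $\partial r$ is bounded. Constants $f_{\inf}\in\mathbb{R}$ and $\kappa_{\nabla f},\kappa_{\partial r},\kappa_c,\kappa_J,L_g,L_J>0$ are fixed so that for all $x,\bar x\in\mathcal{X}$: $f_{\inf}\le f(x)$, $\|\nabla f(x)\|_2\le\kappa_{\nabla f}$, $\|w\|_2\le\kappa_{\partial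 r}$ for all $w\in\partial r(x)$, $\|c(x)\|_2\le\kappa_c$, $\|J(x)\|_2\le\kappa_J$, $\|\nabla f(x)-\nabla f(\bar x)\|_2\le L_g\|x-\bar x\|_2$, $\|J(x)-J(\bar x)\|_2\le L_J\|x-\bar x\|_2$. Sequential constraint qualification. Let $\mathcal{A}_k^v=\{i:[x_k+v_k^c]_i=0\}$ and let $I_{\mathcal{A}_k^v}$ be the rows of the $n\times n$ identity matrix indexed by $\mathcal{A}_k^v$. For all $k\in\mathbb{N}$ the matrix $[J_k^T,I_{\mathcal{A}_k^v}^T]^T$ ($J_k$ stacked on $I_{\mathcal{A}_k^v}$) has full row rank, and there is $\sigma_{\min}>0$ such that its smallest singular value is at least $\sigma_{\min}$ for all $k\in\mathbb{N}$.
   Formalization: The set X is also required to contain all trial points x_k+s_k (otherwise both bounds can fail), and when the floor term is 0 the second bound is replaced by max{0,⌈log(·)/log ξ⌉}, since the printed bound 0 is false in general. *)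

theory Defs
  imports "HOL-Analysis.Analysis"
begin

definition tangent_cone :: "'a::real_normed_vector set \<Rightarrow> 'a \<Rightarrow> 'a set" where
  "tangent_cone S x =
     {d. \<exists>w t. (\<forall>j::nat. w j \<in> S \<and> 0 < t j) \<and> w \<longlonglongrightarrow> x \<and> t \<longlonglongrightarrow> 0 \<and>
           (\<lambda>j. (w j - x) /\<^sub>R t j) \<longlonglongrightarrow> d}"

definition subdifferential :: "('a::real_inner \<Rightarrow> real) \<Rightarrow> 'a \<Rightarrow> 'a set" where
  "subdifferential r x = {w. \<forall>y. r x + w \<bullet> (y - x) \<le> r y}"

definition lin_model :: "real^'m \<Rightarrow> real^'n^'m \<Rightarrow> real^'n \<Rightarrow> real" where
  "lin_model c J v = (norm (c + J *v v))\<^sup>2 / 2"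

text \<open>The test passed by the projected-gradient step \<open>v\<close>;
  \<open>transpose J *v c\<close> is the gradient of \<open>lin_model c J\<close> at \<open>0\<close>.\<close>

definition cauchy_test ::
    "real \<Rightarrow> real \<Rightarrow> real^'m \<Rightarrow> real^'n^'m \<Rightarrow> real^'n \<Rightarrow> bool" where
  "cauchy_test radius \<eta> c J v \<longleftrightarrow>
     norm v \<le> radius \<and>
     lin_model c J v \<le> lin_model c J 0 + \<eta> * ((transpose J *v c) \<bullet> v)"

definition merit ::
    "(real^'n \<Rightarrow> real) \<Rightarrow> (real^'n \<Rightarrow> real) \<Rightarrow> (real^'n \<Rightarrow> real^'m) \<Rightarrow> real \<Rightarrow> real^'n \<Rightarrow> real" where
  "merit f r c \<tau> x = \<tau> * (f x + r x) + norm (c x)"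

text \<open>A matrix whose number of rows varies is represented by the family \<open>M i\<close>, \<open>i \<in> I\<close>, of its
  rows. A singular value is the square root of an eigenvalue of \<open>M M\<^sup>T\<close>, the matrix with entries
  \<open>M i \<bullet> M j\<close>; this yields exactly the singular values of \<open>M\<close> when there are at most as many rows
  as columns, in particular when \<open>M\<close> has full row rank. The set of singular values is finite, and
  nonempty if \<open>I\<close> is, so its infimum is its smallest element.\<close>

definition full_row_rank :: "('k \<Rightarrow> real^'n) \<Rightarrow> 'k set \<Rightarrow> bool" where
  "full_row_rank M I \<longleftrightarrow> dim (M ` I) = card I"

definition singular_values :: "('k \<Rightarrow> real^'n) \<Rightarrow> 'k set \<Rightarrow> real set" where
  "singular_values M I =
     {sqrt \<mu> | \<mu>. \<exists>w. (\<exists>i\<in>I. w i \<noteq> 0) \<and> (\<forall>i\<in>I. (\<Sum>j\<in>I. (M i \<bullet> M j) * w j) = \<mu> * w i)}"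

definition smallest_singular_value :: "('k \<Rightarrow> real^'n) \<Rightarrow> 'k set \<Rightarrow> real" where
  "smallest_singular_value M I = Inf (singular_values M I)"

text \<open>\<open>J\<close> stacked on the rows of the identity matrix with index in \<open>A\<close>: the rows of \<open>stacked J\<close>
  with index in \<open>stacked_rows A\<close>.\<close>

definition stacked :: "real^'n^'m \<Rightarrow> 'm + 'n \<Rightarrow> real^'n" where
  "stacked J = case_sum (\<lambda>i. row i J) (\<lambda>j. row j (mat 1))"

definition stacked_rows :: "'n set \<Rightarrow> ('m + 'n) set" where
  "stacked_rows A = range Inl \<union> Inr ` A"

end

theory Submission
  imports Defs
begin

text \<open>The crux is a lower bound on the decrease of \<open>\<parallel>c\<parallel>\<close> along the Cauchy step \<open>v = v(\<beta>)\<close>. The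
  projected step satisfies \<open>- \<nabla>m(0) \<bullet> v \<ge> \<parallel>v\<parallel>\<^sup>2 / \<beta>\<close>, and \<open>v / \<beta>\<close> differs from \<open>- J\<^sup>T c\<close> only in the
  components active at \<open>x + v\<close>, so the constraint qualification gives \<open>\<parallel>v\<parallel> / \<beta> \<ge> \<sigma>\<^sub>m\<^sub>i\<^sub>n \<parallel>c\<parallel>\<close>.
  (Comparing with \<open>\<delta>\<close> instead would fail: \<open>\<parallel>v\<parallel> / \<beta>\<close> can be much smaller than \<open>\<delta>\<close>.) Backtracking keeps
  \<open>\<beta>\<close> bounded below, which makes the merit parameter and then the step size bounded below. A successful
  step with \<open>\<chi> > \<epsilon>\<close> hence decreases the shifted merit function \<open>\<tau>\<^sub>k (f + r - f\<^sub>i\<^sub>n\<^sub>f) + \<parallel>c\<parallel>\<close>, which is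
  nonnegative and nonincreasing because \<open>\<tau>\<^sub>k\<close> is, by at least \<open>\<kappa>\<^sub>\<Phi> \<epsilon>\<^sup>2\<close>; unsuccessful steps shrink \<open>\<alpha>\<close>
  geometrically and so are bounded in number.\<close>

section \<open>Quadratic remainder bound for Lipschitz derivatives\<close>

text \<open>The remainder is paired with itself, which reduces a vector-valued \<open>F\<close> to
  the real function \<open>h\<close> on [0, 1]. Cauchy-Schwarz makes \<open>h\<close> nonincreasing,
  and \<open>h 1 \<le> h 0\<close> is the claim multiplied by the norm of the remainder. It serves
  both \<open>f\<close> and \<open>c\<close>.\<close>

lemma taylor_lipschitz_derivative:
  fixes F :: "'a::real_normed_vector \<Rightarrow> 'b::real_inner"
  assumes der: "\<And>p. p \<in> X \<Longrightarrow> (F has_derivative F' p) (at p)"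
    and conv: "convex X" and xs: "x \<in> X" "x + s \<in> X"
    and lip: "\<And>p. p \<in> X \<Longrightarrow> norm (F' p s - F' x s) \<le> L * norm (p - x) * norm s"
  shows "norm (F (x + s) - F x - F' x s) \<le> L / 2 * (norm s)\<^sup>2"
proof -
  define w where "w = F (x + s) - F x - F' x s"
  define h where "h t = w \<bullet> F (x + t *\<^sub>R s) - t * (w \<bullet> F' x s) - norm w * L * (norm s)\<^sup>2 * t\<^sup>2 / 2" for t
  have seg: "x + t *\<^sub>R s \<in> X" if "0 \<le> t" "t \<le> 1" for t
  proof -
    have "(1 - t) *\<^sub>R x + t *\<^sub>R (x + s) \<in> X"
      using conv xs that by (intro convexD) auto
    then show ?thesis by (simp add: algebra_simps)
  qed
  have "h 1 \<le> h 0"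
  proof (rule DERIV_nonpos_imp_nonincreasing, simp)
    fix t :: real assume t: "0 \<le> t" "t \<le> 1"
    let ?p = "x + t *\<^sub>R s"
    interpret F': bounded_linear "F' ?p"
      using der[OF seg[OF t]] by (rule has_derivative_bounded_linear)
    have "((\<lambda>t. F (x + t *\<^sub>R s)) has_derivative (\<lambda>d. F' ?p (d *\<^sub>R s))) (at t)"
      by (rule has_derivative_compose[where f = "\<lambda>t. x + t *\<^sub>R s" and g = F, OF _ der[OF seg[OF t]]])
        (auto intro!: derivative_eq_intros)
    then have "((\<lambda>t. w \<bullet> F (x + t *\<^sub>R s)) has_derivative (\<lambda>d. w \<bullet> F' ?p (d *\<^sub>R s))) (at t)"
      by (auto intro!: derivative_eq_intros)
    then have "((\<lambda>t. w \<bullet> F (x + t *\<^sub>R s)) has_real_derivative w \<bullet> F' ?p s) (at t)"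
      by (simp add: has_field_derivative_def F'.scaleR mult_commute_abs)
    then have D: "(h has_real_derivative
        w \<bullet> F' ?p s - w \<bullet> F' x s - norm w * L * (norm s)\<^sup>2 * t) (at t)"
      unfolding h_def by (auto intro!: derivative_eq_intros simp: power2_eq_square)
    have "w \<bullet> F' ?p s - w \<bullet> F' x s \<le> norm w * norm (F' ?p s - F' x s)"
      by (metis inner_diff_right norm_cauchy_schwarz)
    also have "\<dots> \<le> norm w * (L * norm (?p - x) * norm s)"
      by (intro mult_left_mono lip seg t) auto
    also have "\<dots> = norm w * L * (norm s)\<^sup>2 * t"
      using t by (simp add: power2_eq_square)
    finally show "\<exists>y. DERIV h t :> y \<and> y \<le> 0" using D by force
  qed
  then have "w \<bullet> w \<le> norm w * (L * (norm s)\<^sup>2 / 2)"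
    unfolding h_def w_def by (simp add: algebra_simps)
  then have "norm w * norm w \<le> norm w * (L / 2 * (norm s)\<^sup>2)"
    by (simp add: dot_square_norm power2_eq_square)
  then have "norm w \<le> L / 2 * (norm s)\<^sup>2" if "w \<noteq> 0"
    using that mult_le_cancel_left_pos[of "norm w"] by simp
  moreover have "norm w \<le> L / 2 * (norm s)\<^sup>2" if "w = 0"
  proof (cases "s = 0")
    case False
    have "0 \<le> L * norm (x + s - x) * norm s"
      using lip[OF xs(2)] norm_ge_zero order_trans by blast
    then show ?thesis using that by (simp add: power2_eq_square mult.assoc)
  qed (use that in simp)
  ultimately show ?thesis unfolding w_def by blast
qed

section \<open>Smallest singular value as a minimum of the Rayleigh quotient\<close>

lemma norm_add_scaleR_square:
  fixes p q :: "'a::real_inner"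
  shows "(norm (p + t *\<^sub>R q))\<^sup>2 = (norm p)\<^sup>2 + 2 * t * (p \<bullet> q) + t\<^sup>2 * (norm q)\<^sup>2"
  unfolding power2_norm_eq_inner
  by (simp add: inner_add_left inner_add_right inner_commute power2_eq_square)

text \<open>The minimum of the Rayleigh quotient over the unit sphere is an eigenvalue of the Gram
  matrix; this turns the eigenvalue definition into the variational one.\<close>

lemma smallest_singular_value_le:
  fixes M :: "'k::finite \<Rightarrow> real^'n"
  assumes \<sigma>: "0 \<le> \<sigma>" "\<sigma> \<le> smallest_singular_value M I"
  shows "\<sigma>\<^sup>2 * (\<Sum>i\<in>I. (w i)\<^sup>2) \<le> (norm (\<Sum>i\<in>I. w i *\<^sub>R M i))\<^sup>2"
proof (cases "\<forall>i\<in>I. w i = 0")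
  case False
  define T where "T v = (\<Sum>i\<in>I. v $ i *\<^sub>R M i)" for v :: "real^'k"
  define V where "V = {v::real^'k. \<forall>i. i \<notin> I \<longrightarrow> v $ i = 0}"
  have lin: "linear T"
    unfolding T_def by (auto intro!: linearI simp: algebra_simps sum.distrib scaleR_sum_right)
  have subV: "subspace V"
    unfolding V_def subspace_def by auto
  have normV: "(norm v)\<^sup>2 = (\<Sum>i\<in>I. (v $ i)\<^sup>2)" if "v \<in> V" for v
  proof -
    have "(norm v)\<^sup>2 = (\<Sum>i\<in>UNIV. (v $ i)\<^sup>2)"
      unfolding power2_norm_eq_inner inner_vec_def by (simp add: power2_eq_square)
    also have "\<dots> = (\<Sum>i\<in>I. (v $ i)\<^sup>2)"
      using that by (intro sum.mono_neutral_right) (auto simp: V_def)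
    finally show ?thesis .
  qed
  define w0 :: "real^'k" where "w0 = (\<chi> i. if i \<in> I then w i else 0)"
  have w0: "w0 \<in> V" "w0 \<noteq> 0"
    using False by (auto simp: V_def w0_def vec_eq_iff)
  have comp: "compact (sphere 0 1 \<inter> V)"
    by (intro compact_Int_closed compact_sphere closed_subspace subV)
  have ne: "sphere 0 1 \<inter> V \<noteq> {}"
  proof -
    have "w0 /\<^sub>R norm w0 \<in> sphere 0 1 \<inter> V"
      using w0 subV by (auto simp: subspace_scale)
    then show ?thesis by blast
  qed
  have "continuous_on (sphere 0 1 \<inter> V) (\<lambda>v. (norm (T v))\<^sup>2)"
    using lin by (intro continuous_intros linear_continuous_on)
      (simp add: linear_conv_bounded_linear)
  from continuous_attains_inf[OF comp ne this] obtain a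
    where a: "a \<in> sphere 0 1" "a \<in> V"
      and amin: "\<And>v. v \<in> sphere 0 1 \<inter> V \<Longrightarrow> (norm (T a))\<^sup>2 \<le> (norm (T v))\<^sup>2" by auto
  define \<mu> where "\<mu> = (norm (T a))\<^sup>2"
  have Tmin: "\<mu> * (norm v)\<^sup>2 \<le> (norm (T v))\<^sup>2" if "v \<in> V" for v
  proof (cases "v = 0")
    case False
    have "\<mu> \<le> (norm (T (v /\<^sub>R norm v)))\<^sup>2"
      unfolding \<mu>_def using that False subV by (intro amin) (auto simp: subspace_scale)
    also have "\<dots> = (norm (T v))\<^sup>2 / (norm v)\<^sup>2"
      using lin by (simp add: linear_scale power_divide divide_inverse power_mult_distrib power_inverse mult.commute)
    finally show ?thesis using False by (simp add: field_simps)
  qed (simp add: lin linear_0)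
  \<comment> \<open>First-order optimality: by \<open>Tmin\<close>, moving from \<open>a\<close>
    along \<open>h\<close> gives a quadratic in \<open>t\<close> that is nonnegative and vanishes at
    0, so its linear coefficient \<open>2 * B\<close> is zero.\<close>
  have crit: "T a \<bullet> T h = \<mu> * (a \<bullet> h)" if h: "h \<in> V" for h
  proof -
    define B where "B = T a \<bullet> T h - \<mu> * (a \<bullet> h)"
    define C where "C = (norm (T h))\<^sup>2 - \<mu> * (norm h)\<^sup>2"
    have q: "0 \<le> 2 * t * B + t\<^sup>2 * C" for t
    proof -
      have "a + t *\<^sub>R h \<in> V" using a h subV by (simp add: subspace_add subspace_scale)
      from Tmin[OF this] have "\<mu> * ((norm a)\<^sup>2 + 2 * t * (a \<bullet> h) + t\<^sup>2 * (norm h)\<^sup>2)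
          \<le> (norm (T a))\<^sup>2 + 2 * t * (T a \<bullet> T h) + t\<^sup>2 * (norm (T h))\<^sup>2"
        by (simp add: linear_add[OF lin] linear_scale[OF lin] norm_add_scaleR_square)
      moreover have "norm a = 1" using a by simp
      ultimately show ?thesis
        unfolding B_def C_def using \<mu>_def by (simp add: algebra_simps)
    qed
    have "C \<ge> 0" using Tmin[OF h] by (simp add: C_def)
    have "B = 0"
    proof (rule ccontr)
      assume "B \<noteq> 0"
      \<comment> \<open>The trial value \<open>- B / (C + 1)\<close> would make the quadratic
        negative; \<open>C + 1\<close> keeps the denominator positive when
        \<open>C = 0\<close>.\<close>
      have "2 * (- B / (C + 1)) * B + (- B / (C + 1))\<^sup>2 * C = - B\<^sup>2 * (C + 2) / (C + 1)\<^sup>2"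
        using \<open>C \<ge> 0\<close> by (simp add: divide_simps power2_eq_square) (simp add: algebra_simps)
      moreover have "0 < B\<^sup>2 * (C + 2) / (C + 1)\<^sup>2"
        using \<open>C \<ge> 0\<close> \<open>B \<noteq> 0\<close> by (intro divide_pos_pos mult_pos_pos) auto
      ultimately show False using q[of "- B / (C + 1)"] by simp
    qed
    then show ?thesis by (simp add: B_def)
  qed
  have "sqrt \<mu> \<in> singular_values M I"
  proof -
    have "\<exists>i\<in>I. a $ i \<noteq> 0"
      using a normV[of a] by (metis (no_types, lifting) norm_eq_zero mem_sphere_0 sum.neutral
          power_zero_numeral one_power2 zero_neq_one)
    moreover have "(\<Sum>j\<in>I. (M i \<bullet> M j) * a $ j) = \<mu> * a $ i" if "i \<in> I" for i
    proof -
      have "axis i 1 \<in> V" using that by (auto simp: V_def axis_def)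
      moreover have "T (axis i 1) = M i"
        unfolding T_def using that by (subst sum.remove[of _ i]) (auto simp: axis_def)
      ultimately have "T a \<bullet> M i = \<mu> * a $ i"
        using crit[of "axis i 1"] by (simp add: inner_axis)
      then show ?thesis
        unfolding T_def inner_sum_left by (simp add: inner_commute mult.commute)
    qed
    ultimately show ?thesis unfolding singular_values_def by blast
  qed
  \<comment> \<open>\<open>Inf\<close> of a real set is guaranteed to lie below its members only if
    the set is bounded below; here Gram eigenvalues are nonnegative because the quadratic form is a
    squared norm.\<close>
  moreover have "bdd_below (singular_values M I)"
  proof (rule bdd_belowI)
    fix q assume "q \<in> singular_values M I"
    then obtain \<nu> b where q: "q = sqrt \<nu>" and b: "\<exists>i\<in>I. b i \<noteq> 0"
      and eig: "\<And>i. i \<in> I \<Longrightarrow> (\<Sum>j\<in>I. (M i \<bullet> M j) * b j) = \<nu> * b i"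
      unfolding singular_values_def by blast
    have "0 \<le> (\<Sum>i\<in>I. b i *\<^sub>R M i) \<bullet> (\<Sum>i\<in>I. b i *\<^sub>R M i)" by simp
    also have "\<dots> = (\<Sum>i\<in>I. b i * (\<Sum>j\<in>I. (M i \<bullet> M j) * b j))"
      by (simp add: inner_sum_left inner_sum_right sum_distrib_left algebra_simps inner_commute)
    also have "\<dots> = \<nu> * (\<Sum>i\<in>I. (b i)\<^sup>2)"
      unfolding sum_distrib_left[of \<nu>] by (intro sum.cong) (simp_all add: eig power2_eq_square)
    finally have "0 \<le> \<nu> * (\<Sum>i\<in>I. (b i)\<^sup>2)" .
    moreover have "0 < (\<Sum>i\<in>I. (b i)\<^sup>2)"
      using b by (auto intro!: sum_pos2)
    ultimately show "0 \<le> q" using q by (simp add: zero_le_mult_iff)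
  qed
  ultimately have "\<sigma> \<le> sqrt \<mu>"
    using \<sigma>(2) cInf_lower unfolding smallest_singular_value_def by fastforce
  then have "\<sigma>\<^sup>2 \<le> \<mu>"
    using \<sigma>(1) by (metis \<mu>_def real_sqrt_abs abs_norm_cancel power_mono)
  then have "\<sigma>\<^sup>2 * (norm w0)\<^sup>2 \<le> (norm (T w0))\<^sup>2"
    by (meson Tmin[OF w0(1)] order_trans mult_right_mono zero_le_power2)
  moreover have "(norm w0)\<^sup>2 = (\<Sum>i\<in>I. (w i)\<^sup>2)"
    unfolding normV[OF w0(1)] by (simp add: w0_def)
  moreover have "T w0 = (\<Sum>i\<in>I. w i *\<^sub>R M i)"
    by (simp add: T_def w0_def)
  ultimately show ?thesis by simp
qed simp

section \<open>Tangent cones of the orthant and projections onto them\<close>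

text \<open>Difference quotients are nonnegative in the components where \<open>x\<close> vanishes,
  and this survives the limit. Conversely, such a \<open>d\<close> is itself feasible: a common
  \<open>E\<close> for the finitely many components keeps \<open>x + t d\<close> in the orthant, so
  the quotients can be constant.\<close>

lemma tangent_cone_orthant:
  fixes x :: "real^'n"
  assumes x: "0 \<le> x"
  shows "tangent_cone {p. 0 \<le> p} x = {d. \<forall>i. x $ i = 0 \<longrightarrow> 0 \<le> d $ i}"
proof (intro equalityI subsetI)
  fix d :: "real^'n" assume "d \<in> tangent_cone {p. 0 \<le> p} x"
  then obtain w t where w: "\<And>j. 0 \<le> w j" and t: "\<And>j::nat. 0 < t j"
    and lim: "(\<lambda>j. (w j - x) /\<^sub>R t j) \<longlonglongrightarrow> d"
    unfolding tangent_cone_def by auto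
  have "0 \<le> d $ i" if "x $ i = 0" for i
  proof (rule tendsto_lowerbound[OF tendsto_vec_nth[OF lim]])
    show "\<forall>\<^sub>F j in sequentially. 0 \<le> ((w j - x) /\<^sub>R t j) $ i"
      using w t that by (auto simp: less_eq_vec_def less_imp_le)
  qed simp
  then show "d \<in> {d. \<forall>i. x $ i = 0 \<longrightarrow> 0 \<le> d $ i}" by blast
next
  fix d :: "real^'n" assume d: "d \<in> {d. \<forall>i. x $ i = 0 \<longrightarrow> 0 \<le> d $ i}"
  have "\<forall>i. \<exists>e>0. \<forall>t. 0 < t \<and> t \<le> e \<longrightarrow> 0 \<le> x $ i + t * d $ i"
  proof
    fix i
    show "\<exists>e>0. \<forall>t. 0 < t \<and> t \<le> e \<longrightarrow> 0 \<le> x $ i + t * d $ i"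
    proof (cases "x $ i = 0")
      case True
      then show ?thesis using d by (intro exI[of _ 1]) auto
    next
      case False
      then have pos: "0 < x $ i" using x by (auto simp: less_eq_vec_def order_less_le)
      show ?thesis
      proof (intro exI[of _ "x $ i / (\<bar>d $ i\<bar> + 1)"] conjI allI impI)
        fix t assume t: "0 < t \<and> t \<le> x $ i / (\<bar>d $ i\<bar> + 1)"
        then have "t * (\<bar>d $ i\<bar> + 1) \<le> x $ i" by (simp add: field_simps)
        moreover have "t * (- d $ i) \<le> t * (\<bar>d $ i\<bar> + 1)"
          using t by (intro mult_left_mono) auto
        ultimately show "0 \<le> x $ i + t * d $ i" by simp
      qed (use pos in auto)
    qed
  qed
  then obtain e where e: "\<And>i. 0 < e i"
    "\<And>i t. 0 < t \<Longrightarrow> t \<le> e i \<Longrightarrow> 0 \<le> x $ i + t * d $ i" by metis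
  define E where "E = Min (range e)"
  have E: "0 < E" "\<And>i. E \<le> e i" using e(1) by (auto simp: E_def)
  define t where "t j = E * inverse (real (Suc j))" for j
  define w where "w j = x + t j *\<^sub>R d" for j
  have t: "0 < t j" "t j \<le> E" for j
    using E(1) by (auto simp: t_def divide_simps)
  have tlim: "t \<longlonglongrightarrow> 0"
    unfolding t_def using tendsto_mult_right_zero[OF LIMSEQ_inverse_real_of_nat, of E] by simp
  have "w j \<in> {p. 0 \<le> p}" for j
    using e(2)[OF t(1) order_trans[OF t(2) E(2)]] unfolding w_def less_eq_vec_def by simp
  moreover have "w \<longlonglongrightarrow> x"
    unfolding w_def using tendsto_add[OF tendsto_const[of x] tendsto_scaleR[OF tlim tendsto_const[of d]]]
    by simp
  moreover have "(\<lambda>j. (w j - x) /\<^sub>R t j) = (\<lambda>_. d)"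
    using t(1) by (simp add: w_def fun_eq_iff less_imp_neq[symmetric])
  ultimately show "d \<in> tangent_cone {p. 0 \<le> p} x"
    unfolding tangent_cone_def using t(1) tlim
    by (intro CollectI exI[of _ w] exI[of _ t]) simp
qed

text \<open>The set is a product of lines and half-lines, so projection acts separately on each
  component. The predicate \<open>P\<close> lets one computation cover the orthant and its tangent
  cones.\<close>

lemma closest_point_partial_orthant:
  fixes p :: "real^'n"
  shows "closest_point {d. \<forall>i. P i \<longrightarrow> 0 \<le> d $ i} p = (\<chi> i. if P i then max (p $ i) 0 else p $ i)"
    (is "closest_point ?S p = ?q")
proof -
  have "convex ?S"
    by (auto intro!: convexI)
  moreover have "closed ?S"
    by (intro closed_Collect_all closed_Collect_imp closed_Collect_le open_Collect_const continuous_intros)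
  moreover have "?q \<in> ?S" by auto
  moreover have "dist p ?q \<le> dist p d" if "d \<in> ?S" for d
    unfolding dist_norm
  proof (rule norm_le_componentwise_cart)
    show "norm ((p - ?q) $ i) \<le> norm ((p - d) $ i)" for i
      using that by (auto simp: max_def dest!: spec[of _ i])
  qed
  ultimately show ?thesis
    by (intro closest_point_unique[symmetric] ballI)
qed

lemma closest_point_orthant:
  fixes p :: "real^'n"
  shows "closest_point {d. 0 \<le> d} p = (\<chi> i. max (p $ i) 0)"
  using closest_point_partial_orthant[of "\<lambda>_. True" p] unfolding less_eq_vec_def by simp

lemma closest_point_tangent_orthant:
  fixes x :: "real^'n"
  assumes "0 \<le> x"
  shows "closest_point (tangent_cone {p. 0 \<le> p} x) p =
    (\<chi> i. if x $ i = 0 then max (p $ i) 0 else p $ i)"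
  unfolding tangent_cone_orthant[OF assms] by (rule closest_point_partial_orthant)

section \<open>Projected gradient step\<close>

definition projected_step :: "real^'n \<Rightarrow> real^'n \<Rightarrow> real \<Rightarrow> real^'n" where
  "projected_step x d b = closest_point {p. 0 \<le> p} (x - b *\<^sub>R d) - x"

lemma projected_step_nth: "projected_step x d b $ i = max (- b * d $ i) (- x $ i)"
  unfolding projected_step_def closest_point_orthant by (simp add: max_def)

text \<open>Where \<open>x\<close> vanishes both sides clip in the same way; elsewhere clipping at
  \<open>- x $ i\<close> only shortens \<open>- b * d $ i\<close>. Hence the radius condition of the
  Cauchy test holds once \<open>b\<close> is small.\<close>

lemma norm_projected_step_le:
  fixes x :: "real^'n"
  assumes "0 \<le> x" "0 \<le> b"
  shows "norm (projected_step x d b) \<le> b * norm (closest_point (tangent_cone {p. 0 \<le> p} x) (- d))"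
proof -
  have "norm (projected_step x d b) \<le> norm (b *\<^sub>R closest_point (tangent_cone {p. 0 \<le> p} x) (- d))"
  proof (rule norm_le_componentwise_cart)
    fix i
    have "0 \<le> x $ i" using assms(1) by (simp add: less_eq_vec_def)
    moreover have "b * d $ i \<le> 0 \<longleftrightarrow> b = 0 \<or> d $ i \<le> 0" "0 \<le> b * d $ i \<longleftrightarrow> b = 0 \<or> 0 \<le> d $ i"
      using assms(2) by (auto simp: mult_le_0_iff zero_le_mult_iff)
    ultimately show "norm (projected_step x d b $ i)
        \<le> norm ((b *\<^sub>R closest_point (tangent_cone {p. 0 \<le> p} x) (- d)) $ i)"
      using assms(2)
      by (auto simp: projected_step_nth closest_point_tangent_orthant[OF assms(1)] max_def abs_if)
  qed
  then show ?thesis using assms(2) by simp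
qed

text \<open>Componentwise form of the variational inequality of the projection: a clipped component
  satisfies \<open>- b * d $ i \<le> - x $ i \<le> 0\<close>, an unclipped one gives
  equality.\<close>

lemma projected_step_descent:
  fixes x :: "real^'n"
  assumes "0 \<le> x"
  shows "(norm (projected_step x d b))\<^sup>2 \<le> - b * (d \<bullet> projected_step x d b)"
proof -
  have "(norm (projected_step x d b))\<^sup>2 = (\<Sum>i\<in>UNIV. (projected_step x d b $ i)\<^sup>2)"
    unfolding power2_norm_eq_inner inner_vec_def by (simp add: power2_eq_square)
  also have "\<dots> \<le> (\<Sum>i\<in>UNIV. - b * (d $ i * projected_step x d b $ i))"
  proof (rule sum_mono)
    fix i
    have "0 \<le> x $ i" using assms by (simp add: less_eq_vec_def)
    then have "- x $ i * - x $ i \<le> - x $ i * (- b * d $ i)" if "- b * d $ i \<le> - x $ i"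
      using that by (intro mult_left_mono_neg) auto
    then show "(projected_step x d b $ i)\<^sup>2 \<le> - b * (d $ i * projected_step x d b $ i)"
      unfolding projected_step_nth
      by (auto simp: max_def power2_eq_square algebra_simps)
  qed
  also have "\<dots> = - b * (d \<bullet> projected_step x d b)"
    by (simp add: inner_vec_def sum_distrib_left)
  finally show ?thesis .
qed

lemma norm_closest_point_tangent_orthant_le:
  fixes x :: "real^'n"
  assumes "0 \<le> x"
  shows "norm (closest_point (tangent_cone {p. 0 \<le> p} x) p) \<le> norm p"
  by (rule norm_le_componentwise_cart) (simp add: closest_point_tangent_orthant[OF assms] max_def)

lemma norm_transpose_mult_le:
  fixes J :: "real^'n^'m"
  assumes "onorm ((*v) J) \<le> K"
  shows "norm (transpose J *v c) \<le> K * norm c"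
proof -
  let ?d = "transpose J *v c"
  have Jd: "norm (J *v ?d) \<le> K * norm ?d"
    using onorm[OF matrix_vector_mul_bounded_linear, of J ?d]
      mult_right_mono[OF assms norm_ge_zero, of ?d] by linarith
  have "?d \<bullet> ?d = c \<bullet> (J *v ?d)"
    by (simp add: dot_lmul_matrix vector_transpose_matrix)
  also have "\<dots> \<le> norm c * (K * norm ?d)"
    by (intro order_trans[OF norm_cauchy_schwarz] mult_left_mono Jd) auto
  finally have "norm ?d * norm ?d \<le> norm ?d * (K * norm c)"
    by (simp add: dot_square_norm power2_eq_square algebra_simps)
  moreover have "0 \<le> K" using assms onorm_pos_le[OF matrix_vector_mul_bounded_linear] order_trans by blast
  ultimately show ?thesis
    by (cases "?d = 0") (auto simp: mult_le_cancel_left_pos)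
qed

text \<open>On the inactive set the step is \<open>- b d\<close>, so it is a combination of the stacked rows in which
  \<open>J\<close> has the coefficients \<open>- b c\<close>.\<close>

lemma norm_projected_step_ge:
  fixes x :: "real^'n" and J :: "real^'n^'m" and c :: "real^'m" and b :: real
  defines "v \<equiv> \<lambda>b. projected_step x (transpose J *v c) b"
  assumes b: "0 \<le> b" and \<sigma>: "0 \<le> \<sigma>"
    "\<sigma> \<le> smallest_singular_value (stacked J) (stacked_rows {i. (x + v b) $ i = 0})"
  shows "\<sigma> * norm c * b \<le> norm (v b)"
proof -
  define d where "d = transpose J *v c"
  define A where "A = {i. (x + v b) $ i = 0}"
  \<comment> \<open>On a unit row the coefficient is the amount added by clipping, which is zero
    outside \<open>A\<close>. Dropping these squares from the coefficient norm leaves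
    \<open>(b * norm c)\<^sup>2\<close>.\<close>
  define w where "w = case_sum (\<lambda>i. - b * c $ i) (\<lambda>j. v b $ j + b * d $ j)"
  have rows: "(\<Sum>k\<in>stacked_rows A. h k) = (\<Sum>i\<in>UNIV. h (Inl i)) + (\<Sum>j\<in>A. h (Inr j))"
    for h :: "'m + 'n \<Rightarrow> 'b::comm_monoid_add"
    unfolding stacked_rows_def
    by (subst sum.union_disjoint) (auto simp: sum.reindex inj_on_def)
  have comb: "(\<Sum>k\<in>stacked_rows A. w k *\<^sub>R stacked J k) = v b"
  proof (subst vec_eq_iff, intro allI)
    fix l
    have "(\<Sum>i\<in>UNIV. (w (Inl i) *\<^sub>R stacked J (Inl i)) $ l) = - b * d $ l"
      by (simp add: w_def stacked_def row_def d_def matrix_vector_mult_def transpose_def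
          sum_distrib_left sum_negf mult_ac)
    moreover have "(\<Sum>j\<in>A. (w (Inr j) *\<^sub>R stacked J (Inr j)) $ l)
        = (\<Sum>j\<in>A. if j = l then v b $ l + b * d $ l else 0)"
      by (intro sum.cong) (auto simp: w_def stacked_def row_def mat_def)
    moreover have "v b $ l = - b * d $ l" if "l \<notin> A"
      using that unfolding A_def v_def d_def[symmetric] projected_step_nth
      by (auto simp: projected_step_nth max_def split: if_splits)
    ultimately show "(\<Sum>k\<in>stacked_rows A. w k *\<^sub>R stacked J k) $ l = v b $ l"
      by (simp add: rows)
  qed
  have "(norm c)\<^sup>2 = (\<Sum>i\<in>UNIV. (c $ i)\<^sup>2)"
    unfolding power2_norm_eq_inner inner_vec_def by (simp add: power2_eq_square)
  then have "(b * norm c)\<^sup>2 = (\<Sum>i\<in>UNIV. (w (Inl i))\<^sup>2)"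
    by (simp add: w_def power_mult_distrib sum_distrib_left)
  also have "\<dots> \<le> (\<Sum>k\<in>stacked_rows A. (w k)\<^sup>2)"
    by (simp add: rows sum_nonneg)
  finally have "\<sigma>\<^sup>2 * (b * norm c)\<^sup>2 \<le> (norm (v b))\<^sup>2"
    using smallest_singular_value_le[OF \<sigma>, of w] comb
    by (simp add: A_def) (meson mult_left_mono order_trans zero_le_power2)
  then have "(\<sigma> * norm c * b)\<^sup>2 \<le> (norm (v b))\<^sup>2"
    by (simp add: power_mult_distrib mult_ac)
  then show ?thesis
    by (rule power2_le_imp_le) simp
qed

section \<open>Decrease at the Cauchy point\<close>

lemma lin_model_expand:
  fixes J :: "real^'n^'m"
  shows "lin_model c J v = lin_model c J 0 + (transpose J *v c) \<bullet> v + (norm (J *v v))\<^sup>2 / 2"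
proof -
  have "(transpose J *v c) \<bullet> v = c \<bullet> (J *v v)"
    by (simp add: dot_lmul_matrix)
  then show ?thesis
    using norm_add_scaleR_square[of c 1 "J *v v"] by (simp add: lin_model_def field_simps)
qed

text \<open>By the descent inequality the curvature term is at most \<open>b * K\<^sup>2 / 2\<close>
  times the slope \<open>- (d \<bullet> v)\<close>. The third condition on \<open>b\<close> fits
  this into the share \<open>1 - \<eta>\<close> of the slope that the test leaves over.\<close>

lemma cauchy_test_projected_step:
  fixes x :: "real^'n" and J :: "real^'n^'m" and c :: "real^'m"
  defines "d \<equiv> transpose J *v c"
  assumes x: "0 \<le> x" and K: "onorm ((*v) J) \<le> K"
    and b: "0 < b" "b \<le> \<rho>" "b * K\<^sup>2 \<le> 2 * (1 - \<eta>)"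
  shows "cauchy_test (\<rho> * norm (closest_point (tangent_cone {p. 0 \<le> p} x) (- d))) \<eta> c J
    (projected_step x d b)"
proof -
  let ?v = "projected_step x d b"
  have desc: "(norm ?v)\<^sup>2 \<le> - b * (d \<bullet> ?v)"
    by (rule projected_step_descent[OF x])
  then have "0 \<le> b * - (d \<bullet> ?v)"
    using zero_le_power2[of "norm ?v"] by linarith
  then have neg: "0 \<le> - (d \<bullet> ?v)" using b(1) by (simp add: mult_le_0_iff zero_le_mult_iff)
  have "norm (J *v ?v) \<le> K * norm ?v"
    using onorm[OF matrix_vector_mul_bounded_linear, of J ?v]
      mult_right_mono[OF K norm_ge_zero, of ?v] by linarith
  then have "(norm (J *v ?v))\<^sup>2 \<le> K\<^sup>2 * (norm ?v)\<^sup>2"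
    by (metis norm_ge_zero power_mono power_mult_distrib)
  also have "\<dots> \<le> K\<^sup>2 * (- b * (d \<bullet> ?v))"
    by (intro mult_left_mono desc) simp
  also have "\<dots> = b * K\<^sup>2 * - (d \<bullet> ?v)" by simp
  also have "\<dots> \<le> 2 * (1 - \<eta>) * - (d \<bullet> ?v)"
    by (intro mult_right_mono b neg)
  finally have "lin_model c J ?v \<le> lin_model c J 0 + \<eta> * (d \<bullet> ?v)"
    unfolding lin_model_expand[of c J ?v] d_def[symmetric] by (simp add: algebra_simps)
  moreover have "norm ?v \<le> \<rho> * norm (closest_point (tangent_cone {p. 0 \<le> p} x) (- d))"
    using norm_projected_step_le[OF x, of b d] b
    by (meson less_imp_le mult_right_mono norm_ge_zero order_trans)
  ultimately show ?thesis by (simp add: cauchy_test_def d_def)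
qed

lemma cauchy_point_decrease:
  fixes x :: "real^'n" and J :: "real^'n^'m" and c :: "real^'m" and \<rho> \<eta> \<gamma> :: real
  defines "d \<equiv> transpose J *v c"
  defines "i \<equiv> LEAST i. cauchy_test (\<rho> * norm (closest_point (tangent_cone {p. 0 \<le> p} x) (- d))) \<eta> c J
    (projected_step x d (\<gamma> ^ i))"
  defines "v \<equiv> projected_step x d (\<gamma> ^ i)"
  assumes x: "0 \<le> x" and K: "onorm ((*v) J) \<le> K" and \<rho>: "0 < \<rho>"
    and \<gamma>: "0 < \<gamma>" "\<gamma> < 1" and \<eta>: "0 < \<eta>" "\<eta> < 1" and \<sigma>: "0 \<le> \<sigma>"
    "\<sigma> \<le> smallest_singular_value (stacked J) (stacked_rows {i. (x + v) $ i = 0})"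
  shows "lin_model c J v \<le> lin_model c J 0
    - \<gamma> * \<eta> * (1 - \<eta>) * \<sigma>\<^sup>2 * min (1 / (1 + K\<^sup>2)) \<rho> * (norm c)\<^sup>2"
proof -
  define test where "test i \<longleftrightarrow> cauchy_test
    (\<rho> * norm (closest_point (tangent_cone {p. 0 \<le> p} x) (- d))) \<eta> c J (projected_step x d (\<gamma> ^ i))" for i
  define \<mu> where "\<mu> = min (1 / (1 + K\<^sup>2)) \<rho>"
  have pass: "test j" if "\<gamma> ^ j \<le> \<rho>" "\<gamma> ^ j * K\<^sup>2 \<le> 2 * (1 - \<eta>)" for j
    unfolding test_def d_def using that \<gamma> by (intro cauchy_test_projected_step[OF x K]) auto
  \<comment> \<open>A sufficiently small power passes the test, so \<open>LEAST\<close> is attained.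
    Dividing by \<open>1 + K\<^sup>2\<close> rather than \<open>K\<^sup>2\<close> avoids a zero
    denominator.\<close>
  have "0 < min \<rho> (2 * (1 - \<eta>) / (1 + K\<^sup>2))"
    using \<rho> \<eta> by (simp add: add_pos_nonneg)
  then obtain j where j: "\<gamma> ^ j < min \<rho> (2 * (1 - \<eta>) / (1 + K\<^sup>2))"
    using real_arch_pow_inv \<gamma> by blast
  have K1: "0 < 1 + K\<^sup>2" by (simp add: add_pos_nonneg)
  have "\<gamma> ^ j * (1 + K\<^sup>2) < 2 * (1 - \<eta>)"
    using j K1 by (simp add: pos_less_divide_eq)
  moreover have "0 < \<gamma> ^ j" using \<gamma> by simp
  ultimately have "test j" using j by (intro pass) (simp_all add: distrib_left)
  then have test: "test i" unfolding i_def test_def by (rule LeastI)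
  \<comment> \<open>Either no backtracking took place, or the preceding power
    \<open>\<gamma> ^ l\<close> violates one of the two sufficient conditions; the factor
    \<open>\<gamma>\<close> is the price of the last reduction.\<close>
  have low: "\<gamma> * (1 - \<eta>) * \<mu> \<le> \<gamma> ^ i"
  proof (cases i)
    case 0
    have "1 / (1 + K\<^sup>2) \<le> 1" using K1 by (simp add: pos_divide_le_eq)
    then have "\<mu> \<le> 1" unfolding \<mu>_def by linarith
    moreover have "0 \<le> \<mu>" using \<rho> K1 by (simp add: \<mu>_def)
    ultimately have "\<gamma> * (1 - \<eta>) * \<mu> \<le> 1 * 1 * 1"
      using \<gamma> \<eta> by (intro mult_mono) auto
    then show ?thesis using 0 by simp
  next
    case (Suc l)
    have "\<not> test l"
      using not_less_Least[of l test] Suc unfolding i_def test_def by simp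
    then consider "\<rho> < \<gamma> ^ l" | "2 * (1 - \<eta>) < \<gamma> ^ l * K\<^sup>2"
      using pass[of l] by linarith
    then have "(1 - \<eta>) * \<mu> \<le> \<gamma> ^ l"
    proof cases
      case 1
      have "(1 - \<eta>) * \<mu> \<le> 1 * \<rho>"
        using \<eta> \<rho> unfolding \<mu>_def by (intro mult_mono) auto
      then show ?thesis using 1 by simp
    next
      case 2
      have "0 < \<gamma> ^ l" using \<gamma> by simp
      then have "1 - \<eta> \<le> \<gamma> ^ l + \<gamma> ^ l * K\<^sup>2"
        using 2 \<eta> by simp
      then have "1 - \<eta> \<le> \<gamma> ^ l * (1 + K\<^sup>2)" by (simp add: distrib_left)
      then have "(1 - \<eta>) * (1 / (1 + K\<^sup>2)) \<le> \<gamma> ^ l"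
        using K1 by (simp add: pos_divide_le_eq)
      moreover have "(1 - \<eta>) * \<mu> \<le> (1 - \<eta>) * (1 / (1 + K\<^sup>2))"
        unfolding \<mu>_def using \<eta> by (intro mult_left_mono) auto
      ultimately show ?thesis by linarith
    qed
    then have "\<gamma> * ((1 - \<eta>) * \<mu>) \<le> \<gamma> * \<gamma> ^ l" using \<gamma> by simp
    then show ?thesis using Suc by (simp add: mult.assoc)
  qed
  have pos: "0 < \<gamma> ^ i" using \<gamma> by simp
  have "\<sigma> * norm c * \<gamma> ^ i \<le> norm v"
    unfolding v_def d_def using pos \<sigma>
    by (intro norm_projected_step_ge) (simp_all add: v_def d_def)
  then have "(\<sigma> * norm c * \<gamma> ^ i)\<^sup>2 \<le> (norm v)\<^sup>2"
    using \<sigma>(1) pos by (intro power_mono) auto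
  also have "\<dots> \<le> - (\<gamma> ^ i) * (d \<bullet> v)"
    unfolding v_def by (rule projected_step_descent[OF x])
  \<comment> \<open>The lower bound on the squared step is quadratic in \<open>\<gamma> ^ i\<close>,
    the upper bound by the slope is linear, so one power cancels.\<close>
  finally have "\<gamma> ^ i * (\<gamma> ^ i * (\<sigma>\<^sup>2 * (norm c)\<^sup>2)) \<le> \<gamma> ^ i * - (d \<bullet> v)"
    by (simp add: power_mult_distrib power2_eq_square algebra_simps)
  then have "\<gamma> ^ i * (\<sigma>\<^sup>2 * (norm c)\<^sup>2) \<le> - (d \<bullet> v)"
    using pos by (simp only: mult_le_cancel_left_pos)
  moreover have "\<gamma> * (1 - \<eta>) * \<mu> * (\<sigma>\<^sup>2 * (norm c)\<^sup>2) \<le> \<gamma> ^ i * (\<sigma>\<^sup>2 * (norm c)\<^sup>2)"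
    by (intro mult_right_mono low) auto
  ultimately have "\<eta> * (\<gamma> * (1 - \<eta>) * \<mu> * (\<sigma>\<^sup>2 * (norm c)\<^sup>2)) \<le> \<eta> * - (d \<bullet> v)"
    using \<eta> by (intro mult_left_mono) auto
  moreover have "lin_model c J v \<le> lin_model c J 0 + \<eta> * (d \<bullet> v)"
    using test unfolding test_def cauchy_test_def v_def d_def by blast
  ultimately show ?thesis unfolding \<mu>_def by (simp add: algebra_simps)
qed

text \<open>Passes from the squared residual to the residual through
  \<open>1 - 2 * q \<le> (1 - q)\<^sup>2\<close>. Nonnegativity of the squared residual forces
  \<open>q \<le> 1 / 2\<close>, so \<open>1 - q\<close> is nonnegative when roots are taken.\<close>

lemma norm_residual_decrease:
  fixes J :: "real^'n^'m"
  assumes "lin_model c J v \<le> lin_model c J 0 - q * (norm c)\<^sup>2"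
  shows "q * norm c \<le> norm c - norm (c + J *v v)"
proof (cases "c = 0")
  case True
  then show ?thesis using assms by (simp add: lin_model_def)
next
  case False
  have sq: "(norm (c + J *v v))\<^sup>2 \<le> (1 - 2 * q) * (norm c)\<^sup>2"
    using assms by (simp add: lin_model_def field_simps)
  then have "0 \<le> (1 - 2 * q) * (norm c)\<^sup>2" by (meson order_trans zero_le_power2)
  then have q: "q \<le> 1 / 2" using False by (simp add: zero_le_mult_iff)
  have "(1 - 2 * q) * (norm c)\<^sup>2 \<le> (1 - q)\<^sup>2 * (norm c)\<^sup>2"
    by (intro mult_right_mono) (auto simp: power2_eq_square algebra_simps)
  then have "(norm (c + J *v v))\<^sup>2 \<le> ((1 - q) * norm c)\<^sup>2"
    using sq by (simp add: power_mult_distrib)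
  then have "norm (c + J *v v) \<le> (1 - q) * norm c"
    using q by (intro power2_le_imp_le[of "norm (c + J *v v)"]) auto
  then show ?thesis by (simp add: algebra_simps)
qed

section \<open>Complementarity and the full step\<close>

lemma inf_vec_eq_0D:
  fixes a b :: "real^'n"
  assumes "inf a b = 0"
  shows "0 \<le> a" "0 \<le> b" "a \<bullet> b = 0"
proof -
  have i: "min (a $ i) (b $ i) = 0" for i
    using assms by (simp add: vec_eq_iff inf_vec_def inf_min)
  show "0 \<le> a" "0 \<le> b"
    unfolding less_eq_vec_def by (metis i min.cobounded1 min.cobounded2 zero_index)+
  have "a $ i * b $ i = 0" for i
    using i[of i] by (auto simp: min_def split: if_splits)
  then show "a \<bullet> b = 0"
    unfolding inner_vec_def by (intro sum.neutral) simp
qed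

text \<open>In each component either \<open>b = 0\<close> and \<open>a \<ge> - s\<close>, or
  \<open>a = - s\<close> and \<open>b \<ge> 0\<close>; either way the minimum has size at most that
  of \<open>s\<close>. For \<open>a = x k\<close> and \<open>b = - z k\<close> this bounds the
  complementarity part of \<open>chi\<close> by the step length.\<close>

lemma norm_inf_diff_le:
  fixes a b s :: "real^'n"
  assumes "inf (a + s) b = 0"
  shows "norm (inf a b) \<le> norm s"
proof (rule norm_le_componentwise_cart)
  fix i
  have "min (a $ i + s $ i) (b $ i) = 0"
    using assms by (simp add: vec_eq_iff inf_vec_def inf_min)
  then show "norm (inf a b $ i) \<le> norm (s $ i)"
    by (auto simp: inf_vec_def inf_min min_def split: if_splits)
qed

text \<open>Testing the optimality conditions with \<open>u\<close>: the multiplier terms drop out, since \<open>J u = 0\<close>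
  and \<open>z \<bullet> u = - z \<bullet> (x + v) \<ge> 0\<close> by complementarity.\<close>

lemma step_model_le:
  fixes x u v z g gr :: "real^'n" and J :: "real^'n^'m"
  assumes a: "0 < a" and xv: "0 \<le> x + v"
    and gr: "gr \<in> subdifferential r (x + v + u)"
    and stat: "g + (1 / a) *\<^sub>R u + (1 / a) *\<^sub>R v + gr + transpose J *v y + z = 0"
    and Ju: "J *v u = 0" and compl: "inf (x + v + u) (- z) = 0"
  shows "g \<bullet> (v + u) + 1 / (2 * a) * (norm (v + u))\<^sup>2 + r (x + (v + u)) - r x
    \<le> (g + gr) \<bullet> v + 1 / (2 * a) * (norm v)\<^sup>2"
proof -
  have "r (x + v + u) + gr \<bullet> (x - (x + v + u)) \<le> r x"
    using gr unfolding subdifferential_def by blast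
  then have r: "r (x + (v + u)) - r x \<le> gr \<bullet> (v + u)"
    by (simp add: algebra_simps inner_diff_right inner_add_right)
  have "0 \<le> (\<Sum>i\<in>UNIV. (x + v) $ i * (- z) $ i)"
    using inf_vec_eq_0D(2)[OF compl] xv unfolding less_eq_vec_def
    by (intro sum_nonneg mult_nonneg_nonneg) auto
  then have "0 \<le> (x + v) \<bullet> (- z)"
    unfolding inner_vec_def by simp
  moreover have "(x + v + u) \<bullet> (- z) = 0" by (rule inf_vec_eq_0D(3)[OF compl])
  ultimately have zu: "0 \<le> z \<bullet> u"
    by (simp add: inner_add_left inner_add_right inner_commute)
  have "(transpose J *v y) \<bullet> u = 0"
    using Ju by (simp add: dot_lmul_matrix)
  moreover have "(g + (1 / a) *\<^sub>R u + (1 / a) *\<^sub>R v + gr + transpose J *v y + z) \<bullet> u = 0"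
    by (simp only: stat inner_zero_left)
  ultimately have gu: "(g + gr) \<bullet> u \<le> - (1 / a) * ((u + v) \<bullet> u)"
    using zu by (simp add: inner_add_left algebra_simps)
  \<comment> \<open>The proximal term and the cross term from stationarity combine so that
    \<open>u\<close> enters only through its negative square. What remains depends on
    \<open>v\<close>, whose norm is controlled by the residual.\<close>
  have "1 / (2 * a) * (norm (v + u))\<^sup>2 - (1 / a) * ((u + v) \<bullet> u)
      = 1 / (2 * a) * ((norm v)\<^sup>2 - (norm u)\<^sup>2)"
    using a norm_add_scaleR_square[of v 1 u]
    by (simp add: field_simps inner_add_left inner_add_right inner_commute dot_square_norm)
  moreover have "1 / (2 * a) * ((norm v)\<^sup>2 - (norm u)\<^sup>2) \<le> 1 / (2 * a) * (norm v)\<^sup>2"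
    using a by (intro mult_left_mono) auto
  ultimately show ?thesis
    using r gu by (simp add: inner_add_left inner_add_right)
qed

section \<open>Counting by potentials and by step sizes\<close>

lemma card_decrease_le_floor:
  fixes P :: "nat \<Rightarrow> real"
  assumes nonneg: "\<And>k. 0 \<le> P k" and mono: "\<And>k. P (Suc k) \<le> P k"
    and dec: "\<And>k. k \<in> G \<Longrightarrow> P (Suc k) \<le> P k - D" and D: "0 < D"
  shows "int (card {k. k < K \<and> k \<in> G}) \<le> \<lfloor>P 0 / D\<rfloor>"
proof -
  have "P K \<le> P 0 - D * card {k. k < K \<and> k \<in> G}"
  proof (induction K)
    case (Suc K)
    show ?case
    proof (cases "K \<in> G")
      case True
      then have "{k. k < Suc K \<and> k \<in> G} = insert K {k. k < K \<and> k \<in> G}"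
        by (auto simp: less_Suc_eq)
      then show ?thesis using Suc dec[OF True] by (simp add: algebra_simps)
    next
      case False
      then have "{k. k < Suc K \<and> k \<in> G} = {k. k < K \<and> k \<in> G}"
        by (auto simp: less_Suc_eq)
      then show ?thesis using Suc mono[of K] by simp
    qed
  qed simp
  then have "D * card {k. k < K \<and> k \<in> G} \<le> P 0" using nonneg[of K] by linarith
  then show ?thesis using D by (simp add: le_floor_iff pos_le_divide_eq mult.commute)
qed

text \<open>After \<open>n\<close> shrinkings \<open>\<alpha>\<close> equals
  \<open>\<alpha> 0 * \<xi> ^ n\<close>, and one more shrinking requires this to exceed
  \<open>a\<close>. The maximum with 0 covers \<open>a \<ge> \<alpha> 0\<close>, where no shrinking
  occurs.\<close>

lemma card_backtracks_le_ceiling: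
  fixes \<alpha> :: "nat \<Rightarrow> real"
  assumes \<alpha>0: "0 < \<alpha> 0" and \<xi>: "0 < \<xi>" "\<xi> < 1" and a: "0 < a"
    and good: "\<And>k. k \<in> S \<Longrightarrow> \<alpha> (Suc k) = \<alpha> k"
    and bad: "\<And>k. k \<notin> S \<Longrightarrow> \<alpha> (Suc k) = \<xi> * \<alpha> k \<and> a < \<alpha> k"
  shows "int (card {k. k < K \<and> k \<notin> S}) \<le> max 0 \<lceil>ln (a / \<alpha> 0) / ln \<xi>\<rceil>"
proof -
  have "\<alpha> K = \<alpha> 0 * \<xi> ^ card {k. k < K \<and> k \<notin> S} \<and>
    int (card {k. k < K \<and> k \<notin> S}) \<le> max 0 \<lceil>ln (a / \<alpha> 0) / ln \<xi>\<rceil>"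
  proof (induction K)
    case (Suc K)
    define n where "n = card {k. k < K \<and> k \<notin> S}"
    have IH: "\<alpha> K = \<alpha> 0 * \<xi> ^ n" "int n \<le> max 0 \<lceil>ln (a / \<alpha> 0) / ln \<xi>\<rceil>"
      using Suc unfolding n_def by auto
    show ?case
    proof (cases "K \<in> S")
      case True
      then have "{k. k < Suc K \<and> k \<notin> S} = {k. k < K \<and> k \<notin> S}"
        by (auto simp: less_Suc_eq)
      then show ?thesis using Suc good[OF True] by simp
    next
      case False
      then have "{k. k < Suc K \<and> k \<notin> S} = insert K {k. k < K \<and> k \<notin> S}"
        by (auto simp: less_Suc_eq)
      then have card: "card {k. k < Suc K \<and> k \<notin> S} = Suc n" by (simp add: n_def)
      have "a / \<alpha> 0 < \<xi> ^ n"
        using bad[OF False] IH(1) \<alpha>0 by (simp add: pos_divide_less_eq mult.commute)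
      then have "ln (a / \<alpha> 0) < ln (\<xi> ^ n)"
        using a \<alpha>0 \<xi> by simp
      then have "ln (a / \<alpha> 0) < real n * ln \<xi>"
        using \<xi> by (simp add: ln_realpow)
      moreover have "ln \<xi> < 0" using \<xi> by simp
      ultimately have "real n < ln (a / \<alpha> 0) / ln \<xi>"
        by (simp add: neg_less_divide_eq)
      \<comment> \<open>Strictness absorbs the off-by-one: \<open>n\<close> counts the earlier
        shrinkings, and the new count \<open>Suc n\<close> is still at most the ceiling.\<close>
      then have "int n < \<lceil>ln (a / \<alpha> 0) / ln \<xi>\<rceil>" by (simp add: less_ceiling_iff)
      then show ?thesis using card IH(1) bad[OF False] by simp
    qed
  qed simp
  then show ?thesis by blast
qed

text \<open>At most \<open>F\<close> successful and \<open>U\<close> rejected iterations can precede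
  \<open>chi k \<le> \<epsilon>\<close>. The sum \<open>F + U\<close> is at most
  \<open>(U + 1) * F\<close> once \<open>F \<ge> 1\<close>; for \<open>F = 0\<close> the product
  vanishes while the count still allows \<open>U\<close> rejections, hence the separate
  clause.\<close>

theorem theorem5p12:
  fixes f r :: "real^'n \<Rightarrow> real"
    and g :: "real^'n \<Rightarrow> real^'n"
    and c :: "real^'n \<Rightarrow> real^'m"
    and J :: "real^'n \<Rightarrow> real^'n^'m"
    and \<Omega> X :: "(real^'n) set"
    and x v vc u s z gr :: "nat \<Rightarrow> real^'n"
    and y :: "nat \<Rightarrow> real^'m"
    and vpath :: "nat \<Rightarrow> real \<Rightarrow> real^'n"
    and icp :: "nat \<Rightarrow> nat"
    and \<alpha> \<tau> \<tau>prev \<beta> \<delta> A chi :: "nat \<Rightarrow> real"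
    and \<tau>trial :: "nat \<Rightarrow> ereal"
    and S :: "nat set"
    and \<tau>init \<kappa>v \<xi> \<eta>\<Phi> \<sigma>c \<epsilon>\<tau> \<gamma> \<eta>m :: real
    and finf \<kappa>f \<kappa>r \<kappa>c \<kappa>J Lg LJ \<sigma>min :: real
    and \<kappa>1 \<tau>mintrial \<tau>min \<alpha>min \<kappa>\<Phi> \<epsilon> :: real
    and F U :: int
  \<comment> \<open>problem\<close>
  assumes dims: "CARD('m) \<le> CARD('n)"
    and f_grad: "\<And>p. GDERIV f p :> g p" and g_cont: "continuous_on UNIV g"
    and c_jac: "\<And>p. (c has_derivative (\<lambda>h. J p *v h)) (at p)" and J_cont: "continuous_on UNIV J"
    and r_convex: "convex_on UNIV r" and r_nonneg: "\<And>p. 0 \<le> r p"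
    and Omega: "\<Omega> = {p. 0 \<le> p}"
  \<comment> \<open>algorithm: inputs\<close>
    and x0: "x 0 \<in> \<Omega>"
    and pos_inputs: "0 < \<alpha> 0" "0 < \<tau>init" "0 < \<kappa>v"
    and unit_inputs: "\<xi> \<in> {0<..<1}" "\<eta>\<Phi> \<in> {0<..<1}" "\<sigma>c \<in> {0<..<1}" "\<epsilon>\<tau> \<in> {0<..<1}"
      "\<gamma> \<in> {0<..<1}" "\<eta>m \<in> {0<..<1}"
  \<comment> \<open>algorithm: Cauchy point\<close>
    and delta: "\<And>k. \<delta> k =
      norm (closest_point (tangent_cone \<Omega> (x k)) (- (transpose (J (x k)) *v c (x k))))"
    and vpath: "\<And>k b. vpath k b =
      closest_point \<Omega> (x k - b *\<^sub>R (transpose (J (x k)) *v c (x k))) - x k"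
    and icp: "\<And>k. icp k =
      (LEAST i. cauchy_test (\<kappa>v * \<alpha> k * \<delta> k) \<eta>m (c (x k)) (J (x k)) (vpath k (\<gamma> ^ i)))"
    and beta: "\<And>k. \<beta> k = \<gamma> ^ icp k"
    and vc: "\<And>k. vc k = vpath k (\<beta> k)"
  \<comment> \<open>algorithm: normal step\<close>
    and v_zero: "\<And>k. \<delta> k = 0 \<Longrightarrow> v k = 0"
    and v_nonzero: "\<And>k. \<delta> k \<noteq> 0 \<Longrightarrow>
      norm (v k) \<le> \<kappa>v * \<alpha> k * \<delta> k \<and> x k + v k \<in> \<Omega> \<and>
      lin_model (c (x k)) (J (x k)) (v k) \<le> lin_model (c (x k)) (J (x k)) (vc k)"
  \<comment> \<open>algorithm: tangential step and multipliers\<close>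
    and u_min: "\<And>k. is_arg_min
      (\<lambda>w. g (x k) \<bullet> w + 1 / (2 * \<alpha> k) * (norm w)\<^sup>2 + 1 / \<alpha> k * (v k \<bullet> w) + r (x k + v k + w))
      (\<lambda>w. J (x k) *v w = 0 \<and> x k + v k + w \<in> \<Omega>) (u k)"
    and s: "\<And>k. s k = v k + u k"
    and gr_subgrad: "\<And>k. gr k \<in> subdifferential r (x k + v k + u k)"
    and opt_stationarity: "\<And>k. g (x k) + (1 / \<alpha> k) *\<^sub>R u k + (1 / \<alpha> k) *\<^sub>R v k + gr k
      + transpose (J (x k)) *v y k + z k = 0"
    and opt_feasibility: "\<And>k. J (x k) *v u k = 0"
    and opt_complementarity: "\<And>k. inf (x k + v k + u k) (- z k) = 0"
  \<comment> \<open>algorithm: merit parameter\<close>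
    and A: "\<And>k. A k = g (x k) \<bullet> s k + 1 / (2 * \<alpha> k) * (norm (s k))\<^sup>2 + r (x k + s k) - r (x k)"
    and tau_trial: "\<And>k. \<tau>trial k = (if A k \<le> 0 then \<infinity>
      else ereal ((1 - \<sigma>c) * (norm (c (x k)) - norm (c (x k) + J (x k) *v s k)) / A k))"
    and tau_prev: "\<And>k. \<tau>prev k = (case k of 0 \<Rightarrow> \<tau>init | Suc j \<Rightarrow> \<tau> j)"
    and tau: "\<And>k. ereal (\<tau> k) = (if ereal (\<tau>prev k) \<le> \<tau>trial k then ereal (\<tau>prev k)
      else min (ereal ((1 - \<epsilon>\<tau>) * \<tau>prev k)) (\<tau>trial k))"
  \<comment> \<open>algorithm: step acceptance\<close>
    and update: "\<And>k.
      if merit f r c (\<tau> k) (x k + s k) - merit f r c (\<tau> k) (x k)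
         \<le> - \<eta>\<Phi> * (\<tau> k / (4 * \<alpha> k) * (norm (s k))\<^sup>2
              + \<sigma>c * (norm (c (x k)) - norm (c (x k) + J (x k) *v s k)))
      then x (Suc k) = x k + s k \<and> \<alpha> (Suc k) = \<alpha> k
      else x (Suc k) = x k \<and> \<alpha> (Suc k) = \<xi> * \<alpha> k"
    and S: "S = {k. x (Suc k) = x k + s k}"
  \<comment> \<open>no finite termination\<close>
    and no_infeasible_stop: "\<And>k. \<not> (\<delta> k = 0 \<and> c (x k) \<noteq> 0)"
    and no_stationary_stop: "\<And>k. s k \<noteq> 0"
  \<comment> \<open>standing assumption; \<open>X\<close> contains the trial points \<open>x k + s k\<close> as well\<close>
    and X: "open X" "convex X" "\<And>k. x k \<in> X" "\<And>k. x k + v k \<in> X" "\<And>k. x k + s k \<in> X"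
    and f_bounded: "bounded (f ` X)"
    and c_bounded: "\<And>i. bounded ((\<lambda>p. c p $ i) ` X)"
    and g_regular: "bounded (g ` X)" "\<exists>L. L-lipschitz_on X g"
    and J_regular: "\<And>i. bounded ((\<lambda>p. row i (J p)) ` X)" "\<And>i. \<exists>L. L-lipschitz_on X (\<lambda>p. row i (J p))"
    and r_regular: "bounded (\<Union>p\<in>X. subdifferential r p)"
    and pos_constants: "0 < \<kappa>f" "0 < \<kappa>r" "0 < \<kappa>c" "0 < \<kappa>J" "0 < Lg" "0 < LJ"
    and f_inf: "\<And>p. p \<in> X \<Longrightarrow> finf \<le> f p"
    and g_bound: "\<And>p. p \<in> X \<Longrightarrow> norm (g p) \<le> \<kappa>f"
    and r_bound: "\<And>p w. p \<in> X \<Longrightarrow> w \<in> subdifferential r p \<Longrightarrow> norm w \<le> \<kappa>r"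
    and c_bound: "\<And>p. p \<in> X \<Longrightarrow> norm (c p) \<le> \<kappa>c"
    and J_bound: "\<And>p. p \<in> X \<Longrightarrow> onorm ((*v) (J p)) \<le> \<kappa>J"
    and g_lipschitz: "\<And>p q. p \<in> X \<Longrightarrow> q \<in> X \<Longrightarrow> norm (g p - g q) \<le> Lg * norm (p - q)"
    and J_lipschitz: "\<And>p q. p \<in> X \<Longrightarrow> q \<in> X \<Longrightarrow> onorm ((*v) (J p - J q)) \<le> LJ * norm (p - q)"
  \<comment> \<open>sequential constraint qualification\<close>
    and full_rank: "\<And>k. full_row_rank (stacked (J (x k))) (stacked_rows {i. (x k + vc k) $ i = 0})"
    and sigma_min: "0 < \<sigma>min" "\<And>k. \<sigma>min \<le>
      smallest_singular_value (stacked (J (x k))) (stacked_rows {i. (x k + vc k) $ i = 0})"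
  \<comment> \<open>quantities in the bounds\<close>
    and chi: "\<And>k. chi k = Max {norm (g (x k) + gr k + transpose (J (x k)) *v y k + z k),
      norm (c (x k)), norm (inf (x k) (- z k))}"
    and kappa_1: "\<kappa>1 = \<gamma> * \<eta>m * (1 - \<eta>m)"
    and tau_min_trial: "\<tau>mintrial =
      ((1 - \<sigma>c) * \<kappa>1 * \<sigma>min\<^sup>2 * min (1 / ((1 + \<kappa>J\<^sup>2) * \<alpha> 0)) \<kappa>v)
      / (2 * (\<kappa>f + \<kappa>r) * \<kappa>v * \<kappa>J + 2 * \<kappa>v\<^sup>2 * \<kappa>J\<^sup>2 * \<kappa>c)"
    and tau_min: "\<tau>min = min (\<tau> 0) ((1 - \<epsilon>\<tau>) * \<tau>mintrial)"
    and alpha_min: "\<alpha>min = min (\<alpha> 0) (\<xi> * \<tau>min / (2 * (\<tau>min * Lg + LJ)))"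
    and kappa_Phi: "\<kappa>\<Phi> = \<eta>\<Phi> * Min {\<tau>min * \<alpha>min / 8, \<tau>min / (8 * \<alpha> 0),
      \<sigma>c * \<kappa>1 / \<kappa>c * \<sigma>min\<^sup>2 * min (1 / (1 + \<kappa>J\<^sup>2)) (\<kappa>v * \<alpha>min)}"
    and eps: "0 < \<epsilon>"
    and F: "F = \<lfloor>(\<tau> 0 * (f (x 0) + r (x 0) - finf) + norm (c (x 0))) / (\<kappa>\<Phi> * \<epsilon>\<^sup>2)\<rfloor>"
    and U: "U = max 0 \<lceil>ln (\<tau>min / (2 * \<alpha> 0 * (\<tau>min * Lg + LJ))) / ln \<xi>\<rceil>"
  shows "(\<forall>k1 k2. k1 < k2 \<and> (\<forall>k. k1 \<le> k \<and> k < k2 \<longrightarrow> k \<in> S \<and> chi k > \<epsilon>)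
            \<longrightarrow> int k2 - int k1 \<le> F) \<and>
         (F \<noteq> 0 \<longrightarrow> (\<exists>k. chi k \<le> \<epsilon> \<and> int k \<le> (U + 1) * F)) \<and>
         (F = 0 \<longrightarrow> (\<exists>k. chi k \<le> \<epsilon> \<and> int k \<le> U))"
proof -

  \<comment> \<open>Signs and invariants of the iteration\<close>
  define d where "d k = transpose (J (x k)) *v c (x k)" for k
  define \<Delta> where "\<Delta> k = norm (c (x k)) - norm (c (x k) + J (x k) *v s k)" for k
  define \<mu> where "\<mu> a = min (1 / (1 + \<kappa>J\<^sup>2)) (\<kappa>v * a)" for a
  define accept where "accept k \<longleftrightarrow> merit f r c (\<tau> k) (x k + s k) - merit f r c (\<tau> k) (x k)
         \<le> - \<eta>\<Phi> * (\<tau> k / (4 * \<alpha> k) * (norm (s k))\<^sup>2 + \<sigma>c * \<Delta> k)" for k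
  have units: "0 < \<xi>" "\<xi> < 1" "0 < \<eta>\<Phi>" "\<eta>\<Phi> < 1" "0 < \<sigma>c" "\<sigma>c < 1" "0 < \<epsilon>\<tau>" "\<epsilon>\<tau> < 1"
    "0 < \<gamma>" "\<gamma> < 1" "0 < \<eta>m" "\<eta>m < 1"
    using unit_inputs by auto
  have \<kappa>1: "0 < \<kappa>1" unfolding kappa_1 using units by simp
  have K1: "0 < 1 + \<kappa>J\<^sup>2" by (simp add: add_pos_nonneg)

  \<comment> \<open>A rejected step leaves \<open>x\<close> unchanged and could satisfy the equation
    defining \<open>S\<close> only if \<open>s k = 0\<close>, which non-termination
    excludes.\<close>
  have S_iff: "k \<in> S \<longleftrightarrow> accept k" for k
    using update[of k] no_stationary_stop[of k] unfolding S accept_def \<Delta>_def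
    by (auto split: if_splits)
  have step_S: "x (Suc k) = x k + s k" "\<alpha> (Suc k) = \<alpha> k" if "k \<in> S" for k
    using update[of k] that unfolding S_iff accept_def \<Delta>_def by auto
  have step_not_S: "x (Suc k) = x k" "\<alpha> (Suc k) = \<xi> * \<alpha> k" if "k \<notin> S" for k
    using update[of k] that unfolding S_iff accept_def \<Delta>_def by auto

  have trial_nonneg: "0 \<le> x k + s k" for k
    using inf_vec_eq_0D(1)[OF opt_complementarity] unfolding s by (simp add: add.assoc)
  have x_nonneg: "0 \<le> x k" for k
  proof (induction k)
    case 0
    then show ?case using x0 Omega by simp
  next
    case (Suc k)
    then show ?case using trial_nonneg step_S(1) step_not_S(1) by (cases "k \<in> S") auto
  qed
  have \<alpha>: "0 < \<alpha> k \<and> \<alpha> k \<le> \<alpha> 0" for k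
  proof (induction k)
    case (Suc k)
    then have "\<xi> * \<alpha> k \<le> 1 * \<alpha> k" using units by (intro mult_right_mono) auto
    with Suc have "\<xi> * \<alpha> k \<le> \<alpha> 0" by linarith
    then show ?case using Suc step_S(2)[of k] step_not_S(2)[of k] units by (cases "k \<in> S") auto
  qed (use pos_inputs in simp)
  have \<alpha>_pos: "0 < \<alpha> k" and \<alpha>_le: "\<alpha> k \<le> \<alpha> 0" for k using \<alpha> by auto

  \<comment> \<open>Decrease of the linearised constraint violation\<close>
  have d_le: "norm (d k) \<le> \<kappa>J * norm (c (x k))" for k
    unfolding d_def by (intro norm_transpose_mult_le J_bound X)
  have \<delta>_le: "\<delta> k \<le> norm (d k)" for k
    using norm_closest_point_tangent_orthant_le[OF x_nonneg, of k "- d k"]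
    unfolding delta Omega d_def by simp
  have v_le: "norm (v k) \<le> \<kappa>v * \<alpha> k * (\<kappa>J * norm (c (x k)))" for k
  proof -
    have "norm (v k) \<le> \<kappa>v * \<alpha> k * \<delta> k"
      using v_zero[of k] v_nonzero[of k] by (cases "\<delta> k = 0") auto
    also have "\<dots> \<le> \<kappa>v * \<alpha> k * (\<kappa>J * norm (c (x k)))"
      using pos_inputs \<alpha>_pos[of k] \<delta>_le[of k] d_le[of k] by (intro mult_left_mono) auto
    finally show ?thesis .
  qed
  have xv_nonneg: "0 \<le> x k + v k" for k
    using v_zero[of k] v_nonzero[of k] x_nonneg[of k] Omega by (cases "\<delta> k = 0") auto
  have Js: "J (x k) *v s k = J (x k) *v v k" for k
    unfolding s by (simp add: matrix_vector_right_distrib opt_feasibility)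

  have \<Delta>_ge: "\<kappa>1 * \<sigma>min\<^sup>2 * \<mu> (\<alpha> k) * norm (c (x k)) \<le> \<Delta> k" for k
  proof (cases "\<delta> k = 0")
    \<comment> \<open>Non-termination excludes a nonzero residual when
      \<open>\<delta> k = 0\<close>, so both sides vanish.\<close>
    case True
    then show ?thesis using no_infeasible_stop[of k] v_zero[of k] by (simp add: \<Delta>_def Js)
  next
    case False
    have path: "vpath k b = projected_step (x k) (d k) b" for b
      unfolding vpath Omega d_def projected_step_def ..
    have radius: "\<kappa>v * \<alpha> k * \<delta> k =
        \<kappa>v * \<alpha> k * norm (closest_point (tangent_cone {p. 0 \<le> p} (x k)) (- (d k)))"
      unfolding delta Omega d_def ..
    have vc_eq: "vc k = projected_step (x k) (d k) (\<gamma> ^ (LEAST i. cauchy_test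
        (\<kappa>v * \<alpha> k * norm (closest_point (tangent_cone {p. 0 \<le> p} (x k)) (- (d k)))) \<eta>m (c (x k))
        (J (x k)) (projected_step (x k) (d k) (\<gamma> ^ i))))"
      unfolding vc beta icp path radius ..
    have "lin_model (c (x k)) (J (x k)) (vc k) \<le> lin_model (c (x k)) (J (x k)) 0
        - \<gamma> * \<eta>m * (1 - \<eta>m) * \<sigma>min\<^sup>2 * min (1 / (1 + \<kappa>J\<^sup>2)) (\<kappa>v * \<alpha> k) * (norm (c (x k)))\<^sup>2"
      using sigma_min(2)[of k] sigma_min(1) unfolding vc_eq d_def
      by (intro cauchy_point_decrease x_nonneg J_bound X(3) units mult_pos_pos pos_inputs \<alpha>_pos) auto
    then have "lin_model (c (x k)) (J (x k)) (v k) \<le> lin_model (c (x k)) (J (x k)) 0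
        - (\<kappa>1 * \<sigma>min\<^sup>2 * \<mu> (\<alpha> k)) * (norm (c (x k)))\<^sup>2"
      using v_nonzero[OF False] unfolding kappa_1 \<mu>_def by linarith
    then show ?thesis
      unfolding \<Delta>_def Js by (rule norm_residual_decrease)
  qed
  have \<mu>_pos: "0 < \<mu> a" if "0 < a" for a
    unfolding \<mu>_def using that pos_inputs K1 by simp
  have \<Delta>_nonneg: "0 \<le> \<Delta> k" for k
    using \<Delta>_ge[of k] \<kappa>1 \<mu>_pos[OF \<alpha>_pos, of k]
    by (meson mult_nonneg_nonneg norm_ge_zero order_trans less_imp_le zero_le_power2)

  \<comment> \<open>Lower bound on the merit parameter\<close>
  define D where "D = 2 * (\<kappa>f + \<kappa>r) * \<kappa>v * \<kappa>J + 2 * \<kappa>v\<^sup>2 * \<kappa>J\<^sup>2 * \<kappa>c"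
  have D_pos: "0 < D"
    unfolding D_def using pos_constants pos_inputs by (intro add_pos_pos mult_pos_pos) auto
  have A_le: "A k \<le> \<alpha> k * norm (c (x k)) * D / 2" for k
  proof -
    let ?c = "norm (c (x k))"
    have gr: "norm (gr k) \<le> \<kappa>r"
      using r_bound[OF X(5) gr_subgrad[of k, unfolded add.assoc s[symmetric]]] .
    have "A k \<le> (g (x k) + gr k) \<bullet> v k + 1 / (2 * \<alpha> k) * (norm (v k))\<^sup>2"
      unfolding A s by (rule step_model_le[OF \<alpha>_pos xv_nonneg gr_subgrad opt_stationarity
          opt_feasibility opt_complementarity])
    also have "(g (x k) + gr k) \<bullet> v k \<le> (\<kappa>f + \<kappa>r) * (\<kappa>v * \<alpha> k * (\<kappa>J * ?c))"
    proof -
      have "norm (g (x k) + gr k) \<le> \<kappa>f + \<kappa>r"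
        using norm_triangle_le[of "g (x k)" "gr k"] g_bound[OF X(3), of k] gr by simp
      then have "norm (g (x k) + gr k) * norm (v k) \<le> (\<kappa>f + \<kappa>r) * (\<kappa>v * \<alpha> k * (\<kappa>J * ?c))"
        using pos_constants by (intro mult_mono v_le) auto
      then show ?thesis using norm_cauchy_schwarz order_trans by blast
    qed
    also have "1 / (2 * \<alpha> k) * (norm (v k))\<^sup>2 \<le> 1 / (2 * \<alpha> k) * (\<kappa>v * \<alpha> k * (\<kappa>J * ?c))\<^sup>2"
      using \<alpha>_pos[of k] by (intro mult_left_mono power_mono v_le) auto
    also have "\<dots> = (\<kappa>v\<^sup>2 * \<kappa>J\<^sup>2 * \<alpha> k * ?c / 2) * ?c"
      using \<alpha>_pos[of k] by (simp add: power2_eq_square)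
    also have "\<dots> \<le> (\<kappa>v\<^sup>2 * \<kappa>J\<^sup>2 * \<alpha> k * ?c / 2) * \<kappa>c"
      using \<alpha>_pos[of k] by (intro mult_left_mono c_bound X) auto
    finally have "A k \<le> (\<kappa>f + \<kappa>r) * (\<kappa>v * \<alpha> k * (\<kappa>J * ?c)) + (\<kappa>v\<^sup>2 * \<kappa>J\<^sup>2 * \<alpha> k * ?c / 2) * \<kappa>c"
      by simp
    moreover have "0 \<le> (\<kappa>v\<^sup>2 * \<kappa>J\<^sup>2 * \<alpha> k * ?c / 2) * \<kappa>c"
      using \<alpha>_pos[of k] pos_constants by (intro mult_nonneg_nonneg) auto
    ultimately show ?thesis
      unfolding D_def by (simp add: algebra_simps)
  qed
  define E where "E = (1 - \<sigma>c) * \<kappa>1 * \<sigma>min\<^sup>2"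
  have E_pos: "0 < E" unfolding E_def using units \<kappa>1 sigma_min by simp
  have trial_pos: "0 < \<tau>mintrial"
    unfolding tau_min_trial using E_pos D_pos K1 pos_inputs by (simp add: D_def E_def)
  have trial_ge: "ereal \<tau>mintrial \<le> \<tau>trial k" for k
  proof (cases "A k \<le> 0")
    case False
    let ?c = "norm (c (x k))"
    have "\<tau>mintrial * A k \<le> \<tau>mintrial * (\<alpha> k * ?c * D / 2)"
      using trial_pos by (intro mult_left_mono A_le) simp
    also have "\<dots> \<le> \<tau>mintrial * (\<alpha> k * ?c * D)"
      using trial_pos \<alpha>_pos[of k] D_pos by (intro mult_left_mono) auto
    also have "\<dots> = E * (\<alpha> k * min (1 / ((1 + \<kappa>J\<^sup>2) * \<alpha> 0)) \<kappa>v) * ?c"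
      unfolding tau_min_trial using D_pos unfolding D_def[symmetric] E_def[symmetric] by simp
    also have "\<dots> \<le> E * \<mu> (\<alpha> k) * ?c"
    proof (intro mult_right_mono mult_left_mono)
      \<comment> \<open>The division by \<open>\<alpha> 0\<close> in \<open>\<tau>mintrial\<close>
        pays here for the factor \<open>\<alpha> k\<close>, which never exceeds
        \<open>\<alpha> 0\<close>.\<close>
      have "\<alpha> k * (1 / ((1 + \<kappa>J\<^sup>2) * \<alpha> 0)) \<le> 1 / (1 + \<kappa>J\<^sup>2)"
        using \<alpha>_le[of k] \<alpha>_pos[of 0] K1 by (simp add: divide_simps)
      then show "\<alpha> k * min (1 / ((1 + \<kappa>J\<^sup>2) * \<alpha> 0)) \<kappa>v \<le> \<mu> (\<alpha> k)"
        unfolding \<mu>_def using \<alpha>_pos[of k] by (simp add: min_mult_distrib_left min_le_iff_disj mult.commute)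
    qed (use E_pos in auto)
    also have "\<dots> = (1 - \<sigma>c) * (\<kappa>1 * \<sigma>min\<^sup>2 * \<mu> (\<alpha> k) * ?c)" by (simp add: E_def)
    also have "\<dots> \<le> (1 - \<sigma>c) * \<Delta> k"
      using units by (intro mult_left_mono \<Delta>_ge) auto
    finally show ?thesis
      using False unfolding tau_trial by (simp add: \<Delta>_def pos_le_divide_eq)
  qed (simp add: tau_trial)

  have \<tau>_step: "\<tau> k \<le> \<tau>prev k \<and> \<tau> k \<le> \<tau>trial k \<and> min (\<tau>prev k) ((1 - \<epsilon>\<tau>) * \<tau>mintrial) \<le> \<tau> k"
    if "0 < \<tau>prev k" for k
  proof (cases "ereal (\<tau>prev k) \<le> \<tau>trial k")
    case True
    then show ?thesis using tau[of k] by simp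
  next
    case False
    then obtain t where t: "\<tau>trial k = ereal t" "t < \<tau>prev k"
      using trial_ge[of k] by (cases "\<tau>trial k") auto
    \<comment> \<open>When the parameter drops, \<open>t\<close> lies between
      \<open>\<tau>mintrial\<close> and the old value, so both candidates of the minimum are at
      least \<open>(1 - \<epsilon>\<tau>) * \<tau>mintrial\<close>.\<close>
    have "\<tau> k = min ((1 - \<epsilon>\<tau>) * \<tau>prev k) t"
      using tau[of k] False t(1) by (simp flip: ereal_min)
    moreover have "\<tau>mintrial \<le> t" using trial_ge[of k] t by simp
    moreover have "(1 - \<epsilon>\<tau>) * \<tau>mintrial \<le> (1 - \<epsilon>\<tau>) * \<tau>prev k"
      using \<open>\<tau>mintrial \<le> t\<close> t units by (intro mult_left_mono) auto
    moreover have "(1 - \<epsilon>\<tau>) * \<tau>mintrial \<le> 1 * \<tau>mintrial"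
      using units trial_pos by (intro mult_right_mono) auto
    ultimately show ?thesis using t by (auto simp: min_def)
  qed
  have \<tau>0: "0 < \<tau> 0"
  proof -
    have "0 < (1 - \<epsilon>\<tau>) * \<tau>mintrial" using units trial_pos by simp
    then show ?thesis using \<tau>_step[of 0] tau_prev[of 0] pos_inputs by (simp add: min_def split: if_splits)
  qed
  have \<tau>min_pos: "0 < \<tau>min" unfolding tau_min using \<tau>0 units trial_pos by simp
  have \<tau>_ge: "\<tau>min \<le> \<tau> k" for k
  proof (induction k)
    case (Suc k)
    then show ?case using \<tau>_step[of "Suc k"] tau_prev[of "Suc k"] \<tau>min_pos
      by (simp add: min_def tau_min split: if_splits)
  qed (simp add: tau_min)
  have \<tau>_pos: "0 < \<tau> k" for k using \<tau>_ge[of k] \<tau>min_pos by simp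
  have \<tau>prev_pos: "0 < \<tau>prev k" for k
    using tau_prev[of k] pos_inputs \<tau>_pos by (cases k) auto
  have \<tau>_mono: "\<tau> (Suc k) \<le> \<tau> k" for k
    using \<tau>_step[OF \<tau>prev_pos[of "Suc k"]] tau_prev[of "Suc k"] by simp
  have \<tau>A: "\<tau> k * A k \<le> (1 - \<sigma>c) * \<Delta> k" for k
  proof (cases "A k \<le> 0")
    case True
    then show ?thesis
      using \<tau>_pos[of k] \<Delta>_nonneg[of k] units
      by (meson diff_ge_0_iff_ge less_imp_le mult_nonneg_nonneg mult_nonneg_nonpos order_trans)
  next
    case False
    then have "\<tau> k \<le> (1 - \<sigma>c) * \<Delta> k / A k"
      using \<tau>_step[OF \<tau>prev_pos[of k]] tau_trial[of k] by (simp add: \<Delta>_def)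
    then show ?thesis using False by (simp add: pos_le_divide_eq)
  qed

  \<comment> \<open>Acceptance of short steps and lower bound on the step size\<close>
  define abar where "abar = \<tau>min / (2 * (\<tau>min * Lg + LJ))"
  have abar_pos: "0 < abar"
    unfolding abar_def using \<tau>min_pos pos_constants by (simp add: add_pos_pos)
  have accepted: "accept k" if small: "\<alpha> k \<le> abar" for k
  proof -
    let ?n = "(norm (s k))\<^sup>2"
    have gx: "norm (f (x k + s k) - f (x k) - s k \<bullet> g (x k)) \<le> Lg / 2 * ?n"
    proof (rule taylor_lipschitz_derivative[where F' = "\<lambda>p h. h \<bullet> g p", OF _ X(2,3,5)])
      show "(f has_derivative (\<lambda>h. h \<bullet> g p)) (at p)" for p
        using f_grad[of p] by (simp add: gderiv_def)
      show "norm (s k \<bullet> g p - s k \<bullet> g (x k)) \<le> Lg * norm (p - x k) * norm (s k)" if "p \<in> X" for p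
      proof -
        have "norm (s k \<bullet> (g p - g (x k))) \<le> norm (s k) * norm (g p - g (x k))"
          using Cauchy_Schwarz_ineq2 by simp
        also have "\<dots> \<le> norm (s k) * (Lg * norm (p - x k))"
          by (intro mult_left_mono g_lipschitz that X) simp
        finally show ?thesis by (simp add: inner_diff_right mult_ac)
      qed
    qed
    have cx: "norm (c (x k + s k) - c (x k) - J (x k) *v s k) \<le> LJ / 2 * ?n"
    proof (rule taylor_lipschitz_derivative[where F' = "\<lambda>p h. J p *v h", OF c_jac X(2,3,5)])
      show "norm (J p *v s k - J (x k) *v s k) \<le> LJ * norm (p - x k) * norm (s k)" if "p \<in> X" for p
      proof -
        have "norm ((J p - J (x k)) *v s k) \<le> onorm ((*v) (J p - J (x k))) * norm (s k)"
          by (rule onorm[OF matrix_vector_mul_bounded_linear])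
        also have "\<dots> \<le> LJ * norm (p - x k) * norm (s k)"
          by (intro mult_right_mono J_lipschitz that X) simp
        finally show ?thesis by (simp add: matrix_vector_mult_diff_rdistrib)
      qed
    qed
    have f_le: "f (x k + s k) \<le> f (x k) + g (x k) \<bullet> s k + Lg / 2 * ?n"
      using gx unfolding real_norm_def inner_commute[of "s k"] by linarith
    have c_le: "norm (c (x k + s k)) \<le> norm (c (x k) + J (x k) *v s k) + LJ / 2 * ?n"
      using cx norm_triangle_ineq2[of "c (x k + s k)" "c (x k) + J (x k) *v s k"]
      by (simp add: diff_diff_eq)
    \<comment> \<open>Rewriting the change through \<open>A k\<close> subtracts the proximal term
      that \<open>A k\<close> contains; this negative multiple of \<open>?n\<close> has to dominate
      both Taylor remainders.\<close>
    have "\<tau> k * (f (x k + s k) + r (x k + s k)) - \<tau> k * (f (x k) + r (x k))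
        \<le> \<tau> k * (A k - 1 / (2 * \<alpha> k) * ?n + Lg / 2 * ?n)"
      unfolding right_diff_distrib[symmetric] using f_le \<tau>_pos[of k]
      by (intro mult_left_mono) (auto simp: A)
    also have "\<dots> = \<tau> k * A k + (Lg * \<tau> k / 2 - \<tau> k / (2 * \<alpha> k)) * ?n"
      by (simp add: algebra_simps)
    finally have "merit f r c (\<tau> k) (x k + s k) - merit f r c (\<tau> k) (x k)
        \<le> (1 - \<sigma>c) * \<Delta> k + (Lg * \<tau> k / 2 - \<tau> k / (2 * \<alpha> k)) * ?n - \<Delta> k + LJ / 2 * ?n"
      using c_le \<tau>A[of k] unfolding merit_def \<Delta>_def by linarith
    also have "\<dots> = ((\<tau> k * Lg + LJ) / 2 - \<tau> k / (2 * \<alpha> k)) * ?n - \<sigma>c * \<Delta> k"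
      by (simp add: algebra_simps)
    also have "\<dots> \<le> - (\<tau> k / (4 * \<alpha> k)) * ?n - \<sigma>c * \<Delta> k"
    proof -
      have twice: "2 * q * (t / (2 * p)) = t * q / p" for p q t :: real by simp
      have halve: "\<tau> k / (2 * \<alpha> k) = 2 * (\<tau> k / (4 * \<alpha> k))" by simp
      have pos: "0 < \<tau>min * Lg + LJ" "0 < \<tau> k * Lg + LJ"
        using \<tau>min_pos \<tau>_pos[of k] pos_constants by (auto intro!: add_pos_pos)
      \<comment> \<open>The ratio \<open>t / (t * Lg + LJ)\<close> increases with
        \<open>t > 0\<close>, so the threshold built from \<open>\<tau>min\<close> is small enough
        for every \<open>\<tau> k\<close>.\<close>
      have "\<tau>min * (\<tau> k * Lg + LJ) \<le> \<tau> k * (\<tau>min * Lg + LJ)"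
        using mult_right_mono[OF \<tau>_ge[of k], of LJ] pos_constants by (simp add: algebra_simps)
      then have "\<tau>min * (\<tau> k * Lg + LJ) / (\<tau>min * Lg + LJ)
          \<le> \<tau> k * (\<tau>min * Lg + LJ) / (\<tau>min * Lg + LJ)"
        using pos by (intro divide_right_mono) auto
      then have "2 * (\<tau> k * Lg + LJ) * abar \<le> \<tau> k"
        unfolding abar_def twice using pos by simp
      moreover have "2 * (\<tau> k * Lg + LJ) * \<alpha> k \<le> 2 * (\<tau> k * Lg + LJ) * abar"
        using pos small by (intro mult_left_mono) auto
      ultimately have "2 * (\<tau> k * Lg + LJ) * \<alpha> k \<le> \<tau> k" by linarith
      then have "(\<tau> k * Lg + LJ) / 2 \<le> \<tau> k / (4 * \<alpha> k)"
        using \<alpha>_pos[of k] by (simp add: pos_le_divide_eq mult_ac)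
      then have "(\<tau> k * Lg + LJ) / 2 - \<tau> k / (2 * \<alpha> k) \<le> - (\<tau> k / (4 * \<alpha> k))"
        unfolding halve by linarith
      then show ?thesis by (intro diff_right_mono mult_right_mono) auto
    qed
    also have "\<dots> = - 1 * (\<tau> k / (4 * \<alpha> k) * ?n + \<sigma>c * \<Delta> k)" by simp
    also have "\<dots> \<le> - \<eta>\<Phi> * (\<tau> k / (4 * \<alpha> k) * ?n + \<sigma>c * \<Delta> k)"
      using units \<tau>_pos[of k] \<alpha>_pos[of k] \<Delta>_nonneg[of k] by (intro mult_right_mono) auto
    finally show ?thesis unfolding accept_def .
  qed
  have rejected: "abar < \<alpha> k" if "k \<notin> S" for k
    using accepted[of k] that S_iff by force
  have \<alpha>min: "\<alpha>min = min (\<alpha> 0) (\<xi> * abar)"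
    unfolding alpha_min abar_def by simp
  have \<alpha>_ge: "\<alpha>min \<le> \<alpha> k" for k
  proof (induction k)
    case (Suc k)
    \<comment> \<open>A step size is shrunk only above \<open>abar\<close>, so one shrinking leaves
      it above \<open>\<xi> * abar\<close>.\<close>
    have "\<xi> * abar < \<xi> * \<alpha> k" if "k \<notin> S"
      using rejected[OF that] units by simp
    then show ?case
      using Suc step_S(2)[of k] step_not_S(2)[of k] unfolding \<alpha>min by (cases "k \<in> S") auto
  qed (simp add: \<alpha>min)
  have \<alpha>min_pos: "0 < \<alpha>min" unfolding \<alpha>min using abar_pos units \<alpha>_pos[of 0] by simp

  \<comment> \<open>Guaranteed decrease while \<open>chi\<close> is large\<close>
  define m where "m = Min {\<tau>min * \<alpha>min / 8, \<tau>min / (8 * \<alpha> 0),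
      \<sigma>c * \<kappa>1 / \<kappa>c * \<sigma>min\<^sup>2 * min (1 / (1 + \<kappa>J\<^sup>2)) (\<kappa>v * \<alpha>min)}"
  have m: "m \<le> \<tau>min * \<alpha>min / 8" "m \<le> \<tau>min / (8 * \<alpha> 0)" "m \<le> \<sigma>c * \<kappa>1 / \<kappa>c * \<sigma>min\<^sup>2 * \<mu> \<alpha>min"
    unfolding m_def \<mu>_def by (intro Min_le; simp)+
  have m_pos: "0 < m"
    unfolding m_def using \<tau>min_pos \<alpha>min_pos \<alpha>_pos[of 0] units \<kappa>1 pos_constants sigma_min pos_inputs K1
    by (subst Min_gr_iff) auto
  have \<kappa>\<Phi>: "\<kappa>\<Phi> = \<eta>\<Phi> * m" unfolding kappa_Phi m_def ..
  have decrease: "m * \<epsilon>\<^sup>2 \<le> \<tau> k / (4 * \<alpha> k) * (norm (s k))\<^sup>2 + \<sigma>c * \<Delta> k" if large: "\<epsilon> < chi k" for k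
  proof -
    let ?n = "norm (s k)"
    have stat: "norm (g (x k) + gr k + transpose (J (x k)) *v y k + z k) = ?n / \<alpha> k"
    proof -
      have "g (x k) + gr k + transpose (J (x k)) *v y k + z k = - ((1 / \<alpha> k) *\<^sub>R s k)"
        using opt_stationarity[of k] unfolding s by (simp add: algebra_simps eq_neg_iff_add_eq_0)
      then show ?thesis using \<alpha>_pos[of k] by simp
    qed
    have compl: "norm (inf (x k) (- z k)) \<le> ?n"
      using opt_complementarity[of k] unfolding add.assoc s[symmetric] by (rule norm_inf_diff_le)
    have T1: "0 \<le> \<tau> k / (4 * \<alpha> k) * ?n\<^sup>2" using \<tau>_pos[of k] \<alpha>_pos[of k] by simp
    have T2: "0 \<le> \<sigma>c * \<Delta> k" using units \<Delta>_nonneg[of k] by simp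
    \<comment> \<open>Each part of \<open>chi\<close> draws on its own entry of \<open>m\<close>.
      Stationarity is the step length over \<open>\<alpha> k\<close>, complementarity at most the
      step length itself, hence \<open>\<alpha>min\<close> enters one entry as a factor and
      \<open>\<alpha> 0\<close> another as a divisor.\<close>
    consider "\<epsilon> < ?n / \<alpha> k" | "\<epsilon> < norm (c (x k))" | "\<epsilon> < ?n"
      using large compl unfolding chi stat by (auto simp: less_max_iff_disj)
    then show ?thesis
    proof cases
      case 1
      have "m * \<epsilon>\<^sup>2 \<le> (\<tau> k * \<alpha> k / 4) * (?n / \<alpha> k)\<^sup>2"
      proof (intro mult_mono power_mono)
        have "\<tau>min * \<alpha>min \<le> \<tau> k * \<alpha> k"
          using \<tau>_ge[of k] \<alpha>_ge[of k] \<tau>_pos[of k] \<alpha>min_pos by (intro mult_mono) auto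
        moreover have "0 < \<tau>min * \<alpha>min" using \<tau>min_pos \<alpha>min_pos by simp
        ultimately show "m \<le> \<tau> k * \<alpha> k / 4" using m(1) by linarith
      qed (use 1 eps \<tau>_pos[of k] \<alpha>_pos[of k] in auto)
      also have "\<dots> = \<tau> k / (4 * \<alpha> k) * ?n\<^sup>2"
        using \<alpha>_pos[of k] by (simp add: power2_eq_square)
      finally show ?thesis using T2 by simp
    next
      case 2
      let ?c = "norm (c (x k))"
      have c\<kappa>: "?c \<le> \<kappa>c" by (intro c_bound X)
      have "m * \<epsilon>\<^sup>2 \<le> (\<sigma>c * \<kappa>1 / \<kappa>c * \<sigma>min\<^sup>2 * \<mu> (\<alpha> k)) * ?c\<^sup>2"
      proof (intro mult_mono power_mono)
        have "\<mu> \<alpha>min \<le> \<mu> (\<alpha> k)"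
          unfolding \<mu>_def using \<alpha>_ge[of k] pos_inputs by (intro min.mono mult_left_mono) auto
        then have "\<sigma>c * \<kappa>1 / \<kappa>c * \<sigma>min\<^sup>2 * \<mu> \<alpha>min \<le> \<sigma>c * \<kappa>1 / \<kappa>c * \<sigma>min\<^sup>2 * \<mu> (\<alpha> k)"
          using units \<kappa>1 pos_constants by (intro mult_left_mono) auto
        then show "m \<le> \<sigma>c * \<kappa>1 / \<kappa>c * \<sigma>min\<^sup>2 * \<mu> (\<alpha> k)" using m(3) by linarith
        show "0 \<le> \<sigma>c * \<kappa>1 / \<kappa>c * \<sigma>min\<^sup>2 * \<mu> (\<alpha> k)"
          using units \<kappa>1 pos_constants \<mu>_pos[OF \<alpha>_pos, of k] by simp
      qed (use 2 eps in auto)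
      \<comment> \<open>The available decrease is only linear in the residual; the second power is
        bought with \<open>?c / \<kappa>c \<le> 1\<close>, which explains the division by
        \<open>\<kappa>c\<close> in \<open>m\<close>.\<close>
      also have "\<dots> = \<sigma>c * (\<kappa>1 * \<sigma>min\<^sup>2 * \<mu> (\<alpha> k) * ?c) * (?c / \<kappa>c)"
        by (simp add: power2_eq_square)
      also have "\<dots> \<le> \<sigma>c * \<Delta> k * 1"
        using units \<kappa>1 pos_constants \<mu>_pos[OF \<alpha>_pos, of k] \<Delta>_nonneg[of k] c\<kappa>
        by (intro mult_mono \<Delta>_ge mult_left_mono) auto
      finally show ?thesis using T1 by simp
    next
      case 3
      have "m * \<epsilon>\<^sup>2 \<le> (\<tau> k / (4 * \<alpha> k)) * ?n\<^sup>2"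
      proof (intro mult_mono power_mono)
        have "\<tau>min / (8 * \<alpha> 0) \<le> \<tau> k / (4 * \<alpha> k)"
          using \<tau>_ge[of k] \<tau>_pos[of k] \<alpha>_le[of k] \<alpha>_pos[of k] by (intro frac_le) auto
        then show "m \<le> \<tau> k / (4 * \<alpha> k)" using m(2) by linarith
      qed (use 3 eps \<tau>_pos[of k] \<alpha>_pos[of k] in auto)
      then show ?thesis using T2 by simp
    qed
  qed

  \<comment> \<open>Potential function and iteration count\<close>
  define P where "P k = \<tau> k * (f (x k) + r (x k) - finf) + norm (c (x k))" for k
  define G where "G = {k \<in> S. \<epsilon> < chi k}"
  have gap: "0 \<le> f (x k) + r (x k) - finf" for k
    using f_inf[OF X(3), of k] r_nonneg[of "x k"] by simp
  have P_nonneg: "0 \<le> P k" for k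
    unfolding P_def using gap[of k] \<tau>_pos[of k] by simp
  \<comment> \<open>Lowering the parameter at the new point cannot raise the potential since
    \<open>gap\<close> is nonnegative, so only the change of the merit function at fixed
    \<open>\<tau> k\<close> remains.\<close>
  have P_step: "P (Suc k) \<le> P k + (merit f r c (\<tau> k) (x (Suc k)) - merit f r c (\<tau> k) (x k))" for k
    using mult_right_mono[OF \<tau>_mono gap, of k "Suc k"] unfolding P_def merit_def
    by (simp add: algebra_simps)
  have P_S: "P (Suc k) \<le> P k - \<eta>\<Phi> * (\<tau> k / (4 * \<alpha> k) * (norm (s k))\<^sup>2 + \<sigma>c * \<Delta> k)" if "k \<in> S" for k
    using P_step[of k] step_S(1)[OF that] that unfolding S_iff accept_def by simp
  have P_mono: "P (Suc k) \<le> P k" for k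
  proof (cases "k \<in> S")
    case True
    have "0 \<le> \<eta>\<Phi> * (\<tau> k / (4 * \<alpha> k) * (norm (s k))\<^sup>2 + \<sigma>c * \<Delta> k)"
      using units \<tau>_pos[of k] \<alpha>_pos[of k] \<Delta>_nonneg[of k] by simp
    then show ?thesis using P_S[OF True] by simp
  next
    case False
    then show ?thesis using P_step[of k] step_not_S(1) by simp
  qed
  have P_G: "P (Suc k) \<le> P k - \<kappa>\<Phi> * \<epsilon>\<^sup>2" if "k \<in> G" for k
  proof -
    have "\<eta>\<Phi> * (m * \<epsilon>\<^sup>2) \<le> \<eta>\<Phi> * (\<tau> k / (4 * \<alpha> k) * (norm (s k))\<^sup>2 + \<sigma>c * \<Delta> k)"
      using that units by (intro mult_left_mono decrease) (auto simp: G_def)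
    then show ?thesis using P_S[of k] that by (simp add: G_def \<kappa>\<Phi> mult.assoc)
  qed
  have card_G: "int (card {k. k < K \<and> k \<in> G}) \<le> F" for K
  proof -
    have "F = \<lfloor>P 0 / (\<kappa>\<Phi> * \<epsilon>\<^sup>2)\<rfloor>" unfolding F P_def by (simp add: algebra_simps)
    then show ?thesis
      using card_decrease_le_floor[where P = P and G = G, OF P_nonneg P_mono P_G] eps units m_pos by (simp add: \<kappa>\<Phi>)
  qed
  have card_rejected: "int (card {k. k < K \<and> k \<notin> S}) \<le> U" for K
  proof -
    have "U = max 0 \<lceil>ln (abar / \<alpha> 0) / ln \<xi>\<rceil>"
      unfolding U abar_def by (simp add: mult_ac)
    then show ?thesis
      using card_backtracks_le_ceiling[of \<alpha> \<xi> abar S K] units abar_pos pos_inputs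
        step_S(2) step_not_S(2) rejected by simp
  qed
  have "0 \<le> U" unfolding U by simp
  have "0 \<le> F" using card_G[of 0] by simp
  have bound: "int K \<le> F + U" if "\<And>k. k < K \<Longrightarrow> \<epsilon> < chi k" for K
  proof -
    \<comment> \<open>While \<open>chi\<close> exceeds \<open>\<epsilon>\<close>, an iteration is
      rejected or belongs to \<open>G\<close>. Rejections are counted over the whole run, so the two
      bounds add.\<close>
    have "{..<K} = {k. k < K \<and> k \<in> G} \<union> {k. k < K \<and> k \<notin> S}"
      using that by (auto simp: G_def)
    then have "K \<le> card {k. k < K \<and> k \<in> G} + card {k. k < K \<and> k \<notin> S}"
      by (metis card_Un_le card_lessThan)
    then show ?thesis using card_G[of K] card_rejected[of K] by linarith
  qed
  have found: "\<exists>k. chi k \<le> \<epsilon> \<and> int k \<le> B" if B: "F + U \<le> B" for B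
  proof (rule ccontr)
    assume "\<not> ?thesis"
    \<comment> \<open>Indices start at 0, so failure up to \<open>B\<close> covers
      \<open>B + 1\<close> iterations, more than the count permits.\<close>
    then have "int (Suc (nat B)) \<le> F + U"
      using B \<open>0 \<le> F\<close> \<open>0 \<le> U\<close> by (intro bound) (force simp: not_le)
    then show False using B by linarith
  qed
  show ?thesis
  proof (intro conjI impI allI)
    fix k1 k2 assume k: "k1 < k2 \<and> (\<forall>k. k1 \<le> k \<and> k < k2 \<longrightarrow> k \<in> S \<and> chi k > \<epsilon>)"
    then have "card {k1..<k2} \<le> card {k. k < k2 \<and> k \<in> G}"
      by (intro card_mono) (auto simp: G_def)
    then show "int k2 - int k1 \<le> F" using card_G[of k2] k by simp
  next
    assume "F \<noteq> 0"
    then have "U * 1 \<le> U * F" using \<open>0 \<le> F\<close> \<open>0 \<le> U\<close> by (intro mult_left_mono) auto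
    then show "\<exists>k. chi k \<le> \<epsilon> \<and> int k \<le> (U + 1) * F"
      by (intro found) (simp add: algebra_simps)
  next
    assume "F = 0"
    then show "\<exists>k. chi k \<le> \<epsilon> \<and> int k \<le> U" by (intro found) simp
  qed
qed

end
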